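(* Let $\alpha\in\mathbb R$, $\alpha\ne0$, let $P,Q\in\mathrm{SPD}(m)$ with $P\ne Q$, let $(P_0,Q_0)=(P,Q)$, $(P_{n+1},Q_{n+1})=(A_\alpha(P_n,Q_n),M_\alpha(P_n,Q_n))$, and let $$\delta_n:=\frac12\max_{1\le i\le m}\bigl|\log\lambda_i(P_n^{-1}Q_n)\bigr|,$$ where $\lambda_1(X),\dots,\lambda_m(X)$ denote the eigenvalues of $X$. Put $\theta:=\operatorname{artanh}(e^{-|\alpha|\delta_0})$. Then: (1) $\delta_n=|\alpha|^{-1}\log\coth(2^n\theta)$ for every $n\ge0$; (2) $\displaystyle\min\{n\ge0:\delta_n\le\varepsilon\}=\left\lceil\log_2\frac{\operatorname{artanh}(e^{-|\alpha|\varepsilon})}{\theta}\right\rceil$ for every $\varepsilon\in(0,\delta_0)$.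
   Context: $\mathrm{SPD}(m)$ is the manifold of $m\times m$ real symmetric positive-definite matrices with the affine-invariant metric $g_P(X,Y)=\mathrm{tr}(P^{-1}XP^{-1}Y)$, Levi--Civita connection $\nabla^g$, and Euclidean flat connection $\nabla^E$. For $\alpha\in\mathbb R$ let $\nabla^{(\alpha)}:=\nabla^g+\alpha(\nabla^E-\nabla^g)$. $A_\alpha$ and $M_\alpha$ are the geodesic midpoint maps of $\nabla^{(\alpha)}$ and $\nabla^{(-\alpha)}$ (the map sending $(P,Q)$ to $\gamma(1/2)$, $\gamma:[0,1]\to\mathrm{SPD}(m)$ being the unique affinely parametrized geodesic from $P$ to $Q$). Explicitly, for $\alpha\ne0$ and $S=P^{-1/2}QP^{-1/2}$, $$A_\alpha(P,Q)=P^{1/2}\left(\frac{I+S^\alpha}{2}\right)^{1/\alpha}P^{1/2},\qquad M_\alpha(P,Q)=P^{1/2}\left(\frac{I+S^{-\alpha}}{2}\right)^{-1/\alpha}P^{1/2},$$ with principal positive-definite powers. $\operatorname{artanh}$ is the inverse of the hyperbolic tangent. *)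

theory Defs
  imports "HOL-Analysis.Analysis"
begin

definition Sym :: "(real^'n^'n) set" where
  "Sym = {X. transpose X = X}"

definition SPD :: "(real^'n^'n) set" where
  "SPD = {P \<in> Sym. \<forall>x. x \<noteq> 0 \<longrightarrow> x \<bullet> (P *v x) > 0}"

definition ai_metric :: "real^'n^'n \<Rightarrow> real^'n^'n \<Rightarrow> real^'n^'n \<Rightarrow> real" where
  "ai_metric P X Y = trace (matrix_inv P ** X ** matrix_inv P ** Y)"

text \<open>
  \<^const>\<open>SPD\<close> is open in the vector space \<^const>\<open>Sym\<close>, which is thus a global chart and the
  tangent space at each point. A connection is represented in this chart by its Christoffel map
  \<open>\<Gamma>\<close>, i.e. \<open>(\<nabla>\<^sub>X Y)(P) = DY(P)[X] + \<Gamma> P X Y\<close>; only the values for \<open>P\<close> in \<^const>\<open>SPD\<close> and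
  \<open>X\<close>, \<open>Y\<close> in \<^const>\<open>Sym\<close> matter. Affine combinations of connections are affine combinations
  of Christoffel maps.
\<close>

type_synonym 'n christoffel = "real^'n^'n \<Rightarrow> real^'n^'n \<Rightarrow> real^'n^'n \<Rightarrow> real^'n^'n"

definition euclidean_connection :: "('n::finite) christoffel" where
  "euclidean_connection P X Y = 0"

text \<open>
  Torsion-freeness is the symmetry of \<open>\<Gamma> P\<close>. The last conjunct is compatibility with the metric,
  \<open>Z(g(X,Y)) = g(\<nabla>\<^sub>Z X, Y) + g(X, \<nabla>\<^sub>Z Y)\<close>, for vector fields that are constant in the chart (the
  general case follows by the product rule).
\<close>

definition is_levi_civita :: "('n::finite) christoffel \<Rightarrow> bool" where
  "is_levi_civita \<Gamma> \<longleftrightarrow>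
     (\<forall>P\<in>SPD. bilinear (\<Gamma> P) \<and>
        (\<forall>X\<in>Sym. \<forall>Y\<in>Sym. \<Gamma> P X Y \<in> Sym \<and> \<Gamma> P X Y = \<Gamma> P Y X) \<and>
        (\<forall>X\<in>Sym. \<forall>Y\<in>Sym. \<forall>Z\<in>Sym.
           ((\<lambda>t. ai_metric (P + t *\<^sub>R Z) X Y) has_real_derivative
              (ai_metric P (\<Gamma> P Z X) Y + ai_metric P X (\<Gamma> P Z Y))) (at 0)))"

text \<open>
  By the Koszul formula, the choice below is unique where it matters; it is
  \<open>\<Gamma> P X Y = - (X P\<inverse> Y + Y P\<inverse> X) / 2\<close>.
\<close>

definition levi_civita_connection :: "('n::finite) christoffel" where
  "levi_civita_connection = (SOME \<Gamma>. is_levi_civita \<Gamma>)"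

definition alpha_connection :: "real \<Rightarrow> ('n::finite) christoffel" where
  "alpha_connection \<alpha> P X Y =
     levi_civita_connection P X Y
     + \<alpha> *\<^sub>R (euclidean_connection P X Y - levi_civita_connection P X Y)"

text \<open>Affinely parametrized geodesics \<open>[0,1] \<rightarrow> SPD\<close>: \<open>\<gamma>'' + \<Gamma>\<^sub>\<gamma>(\<gamma>', \<gamma>') = 0\<close>.\<close>

definition is_geodesic :: "('n::finite) christoffel \<Rightarrow> (real \<Rightarrow> real^'n^'n) \<Rightarrow> bool" where
  "is_geodesic \<Gamma> \<gamma> \<longleftrightarrow>
     (\<forall>t\<in>{0..1}. \<gamma> t \<in> SPD) \<and>
     (\<exists>\<gamma>'. \<forall>t\<in>{0..1}.
        (\<gamma> has_vector_derivative \<gamma>' t) (at t within {0..1}) \<and>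
        (\<gamma>' has_vector_derivative - \<Gamma> (\<gamma> t) (\<gamma>' t) (\<gamma>' t)) (at t within {0..1}))"

definition geodesic_midpoint :: "('n::finite) christoffel \<Rightarrow> real^'n^'n \<Rightarrow> real^'n^'n \<Rightarrow> real^'n^'n" where
  "geodesic_midpoint \<Gamma> P Q =
     (THE R. \<exists>\<gamma>. is_geodesic \<Gamma> \<gamma> \<and> \<gamma> 0 = P \<and> \<gamma> 1 = Q \<and> R = \<gamma> (1 / 2))"

text \<open>
  For \<open>\<alpha> \<noteq> 0\<close> the geodesic of \<open>alpha_connection \<alpha>\<close> from \<open>P\<close> to \<open>Q\<close> is
  \<open>P\<^sup>1\<^sup>/\<^sup>2 ((1 - t) I + t S\<^sup>\<alpha>)\<^sup>1\<^sup>/\<^sup>\<alpha> P\<^sup>1\<^sup>/\<^sup>2\<close> with \<open>S = P\<^sup>-\<^sup>1\<^sup>/\<^sup>2 Q P\<^sup>-\<^sup>1\<^sup>/\<^sup>2\<close>.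
\<close>

definition A_mid :: "real \<Rightarrow> real^'n^'n \<Rightarrow> real^'n^'n \<Rightarrow> real^'n^'n" where
  "A_mid \<alpha> = geodesic_midpoint (alpha_connection \<alpha>)"

definition M_mid :: "real \<Rightarrow> real^'n^'n \<Rightarrow> real^'n^'n \<Rightarrow> real^'n^'n" where
  "M_mid \<alpha> = geodesic_midpoint (alpha_connection (- \<alpha>))"

definition eigenvalues :: "real^'n^'n \<Rightarrow> real set" where
  "eigenvalues X = {c. \<exists>v. v \<noteq> 0 \<and> X *v v = c *\<^sub>R v}"

text \<open>
  For \<open>P\<close>, \<open>Q\<close> in \<^const>\<open>SPD\<close>, \<open>P\<inverse> Q\<close> is similar to an element of \<^const>\<open>SPD\<close>, so all its complex
  eigenvalues are real and positive and \<^const>\<open>eigenvalues\<close> misses none of them.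
\<close>

definition half_log_spread :: "real^'n^'n \<Rightarrow> real^'n^'n \<Rightarrow> real" where
  "half_log_spread P Q = (1 / 2) * Max ((\<lambda>x. \<bar>ln x\<bar>) ` eigenvalues (matrix_inv P ** Q))"

definition coth :: "real \<Rightarrow> real" where
  "coth x = cosh x / sinh x"

end

theory Submission
  imports Defs
begin

text \<open>
  The \<open>\<alpha>\<close>-connections are invariant under congruence \<open>X \<mapsto> C X C\<^sup>T\<close>, and any two elements of
  \<^const>\<open>SPD\<close> can be written \<open>P = C C\<^sup>T\<close> and \<open>Q = C diag(s) C\<^sup>T\<close>. In such a frame everything becomes
  scalar: the midpoints are \<open>C diag(a) C\<^sup>T\<close> and \<open>C diag(m) C\<^sup>T\<close>, where \<open>a\<close> and \<open>m\<close> are the power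
  means with exponents \<open>\<alpha>\<close> and \<open>-\<alpha>\<close> of \<open>1\<close> and \<open>s\<close>, and \<open>P\<inverse> Q\<close> has the eigenvalues \<open>s\<close>. A scalar
  computation gives \<open>\<bar>ln (m / a)\<bar> / 2 = ln (cosh (\<bar>\<alpha>\<bar> \<bar>ln s\<bar> / 2)) / \<bar>\<alpha>\<bar>\<close>. The right-hand side is
  increasing in \<open>\<bar>ln s\<bar>\<close> and hence commutes with the maximum over the eigenvalues, which yields the
  autonomous recursion \<open>\<bar>\<alpha>\<bar> \<delta>\<^bsub>n+1\<^esub> = ln (cosh (\<bar>\<alpha>\<bar> \<delta>\<^sub>n))\<close>
  (\<open>midpoint_step\<close>). Since \<open>cosh (ln (coth x)) = coth (2 x)\<close>, the substitution
  \<open>\<bar>\<alpha>\<bar> \<delta>\<^sub>n = ln (coth x\<^sub>n)\<close> turns this recursion into \<open>x\<^bsub>n+1\<^esub> = 2 x\<^sub>n\<close>, with \<open>x\<^sub>0 = \<theta>\<close>. This is the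
  first claim; the second follows because \<open>x \<mapsto> ln (coth x)\<close> is decreasing, so that \<open>\<delta>\<^sub>n \<le> \<epsilon>\<close> is a
  lower bound on \<open>2\<^sup>n \<theta>\<close>.

  The substantial part is the midpoint formula (\<open>geodesic_midpoint_alpha_connection\<close>), because the
  midpoints are defined through geodesics and the Levi-Civita connection through its axioms. The
  Koszul argument (\<open>levi_civita_unique\<close>) identifies the Christoffel map, and the geodesic equation
  becomes \<open>\<gamma>'' = (1 - \<alpha>) \<gamma>' \<gamma>\<inverse> \<gamma>'\<close>. It has a matrix-valued logarithmic derivative
  \<open>U = \<gamma>\<inverse> \<gamma>'\<close> that satisfies the Riccati equation \<open>U' = - \<alpha> U\<^sup>2\<close>. After simultaneous diagonalization
  of the initial point and the initial velocity this can be integrated explicitly, so every geodesic is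
  a curve \<open>C diag((1 + \<alpha> t d)\<^sup>1\<^sup>/\<^sup>\<alpha>) C\<^sup>T\<close> (\<open>geodesic_closed_form\<close>). The end points determine its
  midpoint, because applying a scalar function to the diagonal does not depend on the choice of the
  frame \<open>C\<close> (\<open>diag_cong_functional_calculus\<close>).
\<close>

section \<open>Congruences of diagonal matrices\<close>

definition diag :: "('n::finite \<Rightarrow> real) \<Rightarrow> real^'n^'n" where
  "diag d = (\<chi> i j. if i = j then d i else 0)"

definition diag_cong :: "real^'n^'n \<Rightarrow> ('n::finite \<Rightarrow> real) \<Rightarrow> real^'n^'n" where
  "diag_cong C d = C ** diag d ** transpose C"

lemma diag_mult_left: "(diag d ** A) $ i $ j = d i * A $ i $ j"
  by (simp add: diag_def matrix_matrix_mult_def if_distrib if_distribR sum.delta cong: if_cong)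

lemma diag_mult_right: "(A ** diag d) $ i $ j = A $ i $ j * d j"
  by (simp add: diag_def matrix_matrix_mult_def if_distrib if_distribR sum.delta' cong: if_cong)

lemma diag_mult_diag: "diag a ** diag b = diag (\<lambda>i. a i * b i)"
  by (simp add: vec_eq_iff diag_mult_left) (simp add: diag_def)

lemma diag_one: "diag (\<lambda>_. 1) = mat 1"
  by (simp add: diag_def mat_def)

lemma transpose_diag: "transpose (diag d) = diag d"
  by (simp add: diag_def transpose_def vec_eq_iff)

lemma
  assumes "invertible A"
  shows matrix_inv_right: "A ** matrix_inv A = mat 1"
    and matrix_inv_left: "matrix_inv A ** A = mat 1"
  using someI_ex[OF assms[unfolded invertible_def]] by (simp_all add: matrix_inv_def)

lemma matrix_inv_eqI:
  fixes A B :: "real^'n^'n"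
  assumes "A ** B = mat 1"
  shows "matrix_inv A = B"
  by (metis assms invertible_right_inverse matrix_inv_left matrix_mul_assoc matrix_mul_lid
      matrix_mul_rid)

lemma inner_matrix_vector_transpose:
  fixes A :: "real^'n^'n"
  shows "x \<bullet> (A *v y) = (transpose A *v x) \<bullet> y"
  by (simp add: dot_lmul_matrix)

lemma Sym_inner_commute:
  assumes "X \<in> Sym"
  shows "x \<bullet> (X *v y) = y \<bullet> (X *v x)"
proof -
  have "transpose X = X" using assms by (simp add: Sym_def)
  then show ?thesis using inner_matrix_vector_transpose[of x X y] by (simp add: inner_commute)
qed

lemma SPD_pos: "P \<in> SPD \<Longrightarrow> x \<noteq> 0 \<Longrightarrow> x \<bullet> (P *v x) > 0"
  by (simp add: SPD_def)

lemma SPD_imp_Sym: "P \<in> SPD \<Longrightarrow> P \<in> Sym"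
  by (simp add: SPD_def)

text \<open>First-order optimality: a parabola through the origin that stays nonnegative is flat there.\<close>

lemma nonneg_parabola_imp_flat:
  fixes b c :: real
  assumes "\<And>t. 2 * t * b + t\<^sup>2 * c \<ge> 0"
  shows "b = 0"
proof (rule ccontr)
  assume "b \<noteq> 0"
  define s where "s = 1 / (\<bar>c\<bar> + 1)"
  have s: "s > 0" "s * \<bar>c\<bar> < 1" by (auto simp: s_def)
  have "2 * (- s * b) * b + (- s * b)\<^sup>2 * c = s * b\<^sup>2 * (s * c - 2)"
    by (simp add: power2_eq_square algebra_simps)
  moreover have "s * c \<le> s * \<bar>c\<bar>" using s by simp
  then have "s * c - 2 < 0" using s by linarith
  ultimately have "2 * (- s * b) * b + (- s * b)\<^sup>2 * c < 0"
    using s \<open>b \<noteq> 0\<close> by (simp add: mult_pos_neg)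
  with assms[of "- s * b"] show False by linarith
qed

text \<open>
  The spectral theorem for the pencil \<open>X - l P\<close>, by deflation: a maximizer of the Rayleigh quotient
  \<open>(x \<bullet> X x) / (x \<bullet> P x)\<close> over the \<open>P\<close>-orthogonal complement of the eigenvectors already found is one
  more eigenvector. Working with the inner product given by \<open>P\<close> treats both forms at once and
  avoids matrix square roots.
\<close>

lemma generalized_eigenvectors:
  fixes P X :: "real^'n^'n" and I :: "'n set"
  assumes P: "P \<in> SPD" and X: "X \<in> Sym"
  shows "\<exists>v l. \<forall>i\<in>I. X *v v i = l i *\<^sub>R (P *v v i) \<and>
           (\<forall>j\<in>I. v i \<bullet> (P *v v j) = (if i = j then 1 else 0))"
proof -
  have "finite I" by simp
  then show ?thesis
  proof (induction I rule: finite_induct)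
    case empty
    then show ?case by simp
  next
    case (insert k I)
    then obtain v l where
      eig: "\<And>i. i \<in> I \<Longrightarrow> X *v v i = l i *\<^sub>R (P *v v i)" and
      orth: "\<And>i j. i \<in> I \<Longrightarrow> j \<in> I \<Longrightarrow> v i \<bullet> (P *v v j) = (if i = j then 1 else 0)"
      by blast
    have Pc: "x \<bullet> (P *v y) = y \<bullet> (P *v x)" for x y
      using Sym_inner_commute[OF SPD_imp_Sym[OF P]] .
    have Xc: "x \<bullet> (X *v y) = y \<bullet> (X *v x)" for x y
      using Sym_inner_commute[OF X] .
    define S where "S = {x. \<forall>i\<in>I. x \<bullet> (P *v v i) = 0}"
    \<comment> \<open>\<open>I\<close> misses \<open>k\<close>, so the conditions that define \<open>S\<close> are fewer than the dimension\<close>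
    define W where "W = (\<lambda>i. P *v v i) ` I"
    have subS: "subspace S"
      by (auto simp: S_def subspace_def inner_add_left)
    have closedS: "closed S" by (rule closed_subspace[OF subS])
    have "dim W \<le> card W"
      by (rule dim_le_card') (simp add: W_def)
    also have "\<dots> \<le> card I" unfolding W_def by (rule card_image_le) simp
    also have "\<dots> < card (insert k I)" using insert by simp
    also have "\<dots> \<le> CARD('n)" by (rule card_mono) auto
    finally have "dim W < DIM(real^'n)" by simp
    from orthogonal_to_subspace_exists[OF this]
    obtain z where z: "z \<noteq> 0" "\<And>y. y \<in> span W \<Longrightarrow> orthogonal z y" by metis
    have zS: "z \<in> S"
      unfolding S_def mem_Collect_eq orthogonal_def[symmetric]
      by (intro ballI z(2) span_base) (simp add: W_def)
    define K where "K = S \<inter> sphere 0 1"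
    have cK: "compact K" unfolding K_def using closedS by (intro closed_Int_compact compact_sphere)
    have "z /\<^sub>R norm z \<in> K"
      unfolding K_def using z(1) zS subspace_scale[OF subS] by auto
    then have neK: "K \<noteq> {}" by auto
    have Knz: "x \<noteq> 0" if "x \<in> K" for x using that by (auto simp: K_def)
    have "continuous_on K (\<lambda>x. (x \<bullet> (X *v x)) / (x \<bullet> (P *v x)))"
    proof (intro continuous_intros)
      show "\<forall>x\<in>K. x \<bullet> (P *v x) \<noteq> 0" using SPD_pos[OF P] Knz by fastforce
    qed
    from continuous_attains_sup[OF cK neK this] obtain x where x: "x \<in> K" and
      mx: "\<And>y. y \<in> K \<Longrightarrow> (y \<bullet> (X *v y)) / (y \<bullet> (P *v y)) \<le> (x \<bullet> (X *v x)) / (x \<bullet> (P *v x))"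
      by blast
    define m where "m = (x \<bullet> (X *v x)) / (x \<bullet> (P *v x))"
    have xS: "x \<in> S" and x0: "x \<noteq> 0" using x Knz by (auto simp: K_def)
    have Pp: "y \<noteq> 0 \<Longrightarrow> y \<bullet> (P *v y) > 0" for y using SPD_pos[OF P] .
    \<comment> \<open>\<open>q\<close> is a quadratic form, nonnegative on \<open>S\<close> with a zero at \<open>x\<close>; its slope at \<open>x\<close> is \<open>2 w\<close>\<close>
    define q where "q y = m * (y \<bullet> (P *v y)) - y \<bullet> (X *v y)" for y
    have q_nonneg: "q y \<ge> 0" if "y \<in> S" for y
    proof (cases "y = 0")
      case False
      have "y /\<^sub>R norm y \<in> K" unfolding K_def using False that subspace_scale[OF subS] by auto
      from mx[OF this] have "(y \<bullet> (X *v y)) / (y \<bullet> (P *v y)) \<le> m"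
        using False by (simp add: m_def matrix_vector_mult_scaleR)
      then show ?thesis using Pp[OF False] by (simp add: q_def divide_le_eq)
    qed (simp add: q_def)
    have qx: "q x = 0" using Pp[OF x0] by (simp add: q_def m_def)
    define w where "w = m *\<^sub>R (P *v x) - X *v x"
    have wS: "y \<bullet> w = 0" if "y \<in> S" for y
    proof (rule nonneg_parabola_imp_flat)
      fix t
      have "0 \<le> q (x + t *\<^sub>R y)"
        using q_nonneg subspace_add[OF subS xS subspace_scale[OF subS that]] by simp
      also have "q (x + t *\<^sub>R y) = q x + 2 * t * (y \<bullet> w) + t\<^sup>2 * q y"
        by (simp add: q_def w_def inner_diff_right matrix_vector_right_distrib
            matrix_vector_mult_scaleR inner_add_left inner_add_right Pc[of x y] Xc[of x y])
           (simp add: algebra_simps power2_eq_square)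
      finally show "2 * t * (y \<bullet> w) + t\<^sup>2 * q y \<ge> 0" using qx by simp
    qed
    have wv: "v i \<bullet> w = 0" if "i \<in> I" for i
    proof -
      have "v i \<bullet> (P *v x) = 0" using xS that Pc by (simp add: S_def)
      moreover have "v i \<bullet> (X *v x) = 0"
        using xS that by (simp add: Xc[of "v i"] eig S_def)
      ultimately show ?thesis by (simp add: w_def inner_diff_right)
    qed
    have "w = 0"
    proof -
      \<comment> \<open>\<open>w\<close> is orthogonal to \<open>S\<close> and to all \<open>v i\<close>, and \<open>p\<close> is the part of \<open>w\<close> outside \<open>S\<close>\<close>
      define p where "p = (\<Sum>i\<in>I. (w \<bullet> (P *v v i)) *\<^sub>R v i)"
      have "w - p \<in> S"
        unfolding S_def
      proof safe
        fix j assume j: "j \<in> I"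
        have "p \<bullet> (P *v v j) = (\<Sum>i\<in>I. (w \<bullet> (P *v v i)) * (if i = j then 1 else 0))"
          unfolding p_def inner_sum_left using orth j by (intro sum.cong) auto
        also have "\<dots> = w \<bullet> (P *v v j)" using j insert by (simp add: if_distrib sum.delta cong: if_cong)
        finally show "(w - p) \<bullet> (P *v v j) = 0" by (simp add: inner_diff_left)
      qed
      then have "(w - p) \<bullet> w = 0" by (rule wS)
      moreover have "p \<bullet> w = 0" by (simp add: p_def inner_sum_left wv)
      ultimately show "w = 0" by (simp add: inner_diff_left)
    qed
    then have eigx: "X *v x = m *\<^sub>R (P *v x)" by (simp add: w_def)
    define r where "r = sqrt (x \<bullet> (P *v x))"
    have r: "r > 0" "r * r = x \<bullet> (P *v x)" using Pp[OF x0] by (auto simp: r_def)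
    define v' where "v' = v(k := x /\<^sub>R r)"
    define l' where "l' = l(k := m)"
    have nk: "i \<in> I \<Longrightarrow> i \<noteq> k" for i using insert by auto
    show ?case
    proof (intro exI[of _ v'] exI[of _ l'] ballI conjI)
      fix i assume i: "i \<in> insert k I"
      then show "X *v v' i = l' i *\<^sub>R (P *v v' i)"
        by (cases "i = k") (auto simp: v'_def l'_def eigx eig matrix_vector_mult_scaleR)
      fix j assume j: "j \<in> insert k I"
      have "x \<bullet> (P *v x) / (r * r) = 1" using r x0 Pp[OF x0] by simp
      moreover have xv: "x \<bullet> (P *v v i) = 0" if "i \<in> I" for i
        using xS that by (simp add: S_def)
      moreover have "v i \<bullet> (P *v x) = 0" if "i \<in> I" for i
        using xv[OF that] Pc[of "v i" x] by simp
      ultimately show "v' i \<bullet> (P *v v' j) = (if i = j then 1 else 0)"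
        using i j nk
        by (cases "i = k"; cases "j = k")
          (auto simp: v'_def orth matrix_vector_mult_scaleR divide_inverse mult_ac)
    qed
  qed
qed

lemma simultaneous_diagonalization:
  fixes P X :: "real^'n^'n"
  assumes "P \<in> SPD" "X \<in> Sym"
  obtains C d where "invertible C" "P = diag_cong C (\<lambda>_. 1)" "X = diag_cong C d"
proof -
  obtain v :: "'n \<Rightarrow> real^'n" and l where vl: "\<forall>i. X *v v i = l i *\<^sub>R (P *v v i) \<and>
      (\<forall>j. v i \<bullet> (P *v v j) = (if i = j then 1 else 0))"
    using generalized_eigenvectors[OF assms, of UNIV] by auto
  then have eig: "X *v v i = l i *\<^sub>R (P *v v i)"
    and orth: "v i \<bullet> (P *v v j) = (if i = j then 1 else 0)" for i j by blast+
  \<comment> \<open>columns: the \<open>P\<close>-orthonormal eigenvectors, so that \<open>B\<^sup>T P B = I\<close> and \<open>C\<close> is the inverse of \<open>B\<^sup>T\<close>\<close>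
  define B :: "real^'n^'n" where "B = (\<chi> i j. v j $ i)"
  have comp: "(transpose B ** A ** B) $ i $ j = v i \<bullet> (A *v v j)" for A i j
  proof -
    have "(transpose B ** (A ** B)) $ i $ j = v i \<bullet> (A *v v j)"
      by (simp add: matrix_matrix_mult_def B_def transpose_def inner_vec_def
          matrix_vector_mult_def)
    then show ?thesis by (simp add: matrix_mul_assoc)
  qed
  have BP: "transpose B ** P ** B = mat 1"
    by (simp add: vec_eq_iff comp orth mat_def)
  have BX: "transpose B ** X ** B = diag l"
    by (simp add: vec_eq_iff comp orth eig diag_def)
  have iB: "invertible B" using BP invertible_left_inverse by blast
  define C where "C = transpose (matrix_inv B)"
  have CB: "C ** transpose B = mat 1" "transpose B ** C = mat 1"
    "B ** transpose C = mat 1" "transpose C ** B = mat 1"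
    using matrix_inv_right[OF iB] matrix_inv_left[OF iB]
    by (auto simp: C_def matrix_transpose_mul[symmetric])
  have rec: "A = C ** (transpose B ** A ** B) ** transpose C" for A
  proof -
    have "C ** (transpose B ** A ** B) ** transpose C = (C ** transpose B) ** A ** (B ** transpose C)"
      by (simp add: matrix_mul_assoc)
    then show ?thesis by (simp add: CB)
  qed
  show ?thesis
  proof
    show "invertible C" using CB invertible_right_inverse by blast
    show "P = diag_cong C (\<lambda>_. 1)" using rec[of P] BP by (simp add: diag_cong_def diag_one)
    show "X = diag_cong C l" using rec[of X] BX by (simp add: diag_cong_def)
  qed
qed

lemma diag_cong_Sym: "diag_cong C d \<in> Sym"
  by (simp add: Sym_def diag_cong_def matrix_transpose_mul transpose_diag matrix_mul_assoc)

lemma inner_diag_cong: "x \<bullet> (diag_cong C d *v x) = (\<Sum>i\<in>UNIV. d i * ((transpose C *v x) $ i)\<^sup>2)"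
proof -
  have "x \<bullet> (diag_cong C d *v x) = x \<bullet> (C *v (diag d *v (transpose C *v x)))"
    by (simp only: diag_cong_def matrix_vector_mul_assoc matrix_mul_assoc)
  also have "\<dots> = (transpose C *v x) \<bullet> (diag d *v (transpose C *v x))"
    by (rule inner_matrix_vector_transpose)
  also have "\<dots> = (\<Sum>i\<in>UNIV. d i * ((transpose C *v x) $ i)\<^sup>2)"
    unfolding inner_vec_def
    by (rule sum.cong) (simp_all add: matrix_vector_mult_def diag_def if_distrib if_distribR
        sum.delta power2_eq_square cong: if_cong)
  finally show ?thesis .
qed

lemma transpose_mult_nonzero:
  fixes C :: "real^'n^'n"
  assumes "invertible C" "x \<noteq> 0"
  shows "transpose C *v x \<noteq> 0"
  by (metis assms injD inj_matrix_vector_mult matrix_vector_mult_0_right transpose_invertible)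

lemma diag_cong_SPD_iff:
  assumes C: "invertible C"
  shows "diag_cong C d \<in> SPD \<longleftrightarrow> (\<forall>i. d i > 0)"
proof safe
  fix i assume "diag_cong C d \<in> SPD"
  define x where "x = transpose (matrix_inv C) *v axis i 1"
  have "transpose C *v x = axis i 1"
    by (simp only: x_def matrix_vector_mul_assoc matrix_transpose_mul[symmetric]
        matrix_inv_left[OF C] transpose_mat matrix_vector_mul_lid)
  moreover from this have "x \<noteq> 0" by (auto simp: axis_eq_0_iff)
  ultimately have "(\<Sum>j\<in>UNIV. d j * ((axis i 1 :: real^'a) $ j)\<^sup>2) > 0"
    using SPD_pos[OF \<open>diag_cong C d \<in> SPD\<close> \<open>x \<noteq> 0\<close>] inner_diag_cong[of x C d] by metis
  then show "d i > 0"
    by (simp add: axis_def if_distrib if_distribR sum.delta' power2_eq_square cong: if_cong)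
next
  assume d: "\<forall>i. d i > 0"
  have "x \<bullet> (diag_cong C d *v x) > 0" if x: "x \<noteq> 0" for x
  proof -
    obtain i where i: "(transpose C *v x) $ i \<noteq> 0"
      using transpose_mult_nonzero[OF C x] unfolding vec_eq_iff by auto
    show ?thesis unfolding inner_diag_cong
      by (rule sum_pos2[of _ i]) (use i d in \<open>auto simp: less_imp_le\<close>)
  qed
  then show "diag_cong C d \<in> SPD" using diag_cong_Sym by (auto simp: SPD_def)
qed

lemma SPD_diagonalization:
  assumes P: "P \<in> SPD" and Q: "Q \<in> SPD"
  obtains C s where "invertible C" "P = diag_cong C (\<lambda>_. 1)" "Q = diag_cong C s" "\<And>i. s i > 0"
  using simultaneous_diagonalization[OF P SPD_imp_Sym[OF Q]] Q diag_cong_SPD_iff by metis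

lemma diag_cong_mult:
  assumes C: "invertible C"
  shows "(transpose (matrix_inv C) ** diag a ** matrix_inv C) ** diag_cong C b =
         transpose (matrix_inv C) ** diag (\<lambda>i. a i * b i) ** transpose C"
proof -
  have "(transpose (matrix_inv C) ** diag a ** matrix_inv C) ** diag_cong C b =
     transpose (matrix_inv C) ** diag a ** (matrix_inv C ** C) ** diag b ** transpose C"
    by (simp only: diag_cong_def matrix_mul_assoc)
  also have "\<dots> = transpose (matrix_inv C) ** (diag a ** diag b) ** transpose C"
    by (simp add: matrix_inv_left[OF C] matrix_mul_assoc)
  finally show ?thesis by (simp add: diag_mult_diag)
qed

lemma matrix_inv_diag_cong:
  assumes C: "invertible C" and d: "\<And>i. d i \<noteq> 0"
  shows "matrix_inv (diag_cong C d) = transpose (matrix_inv C) ** diag (\<lambda>i. inverse (d i)) ** matrix_inv C"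
proof (rule matrix_inv_eqI)
  have "(transpose (matrix_inv C) ** diag (\<lambda>i. inverse (d i)) ** matrix_inv C) ** diag_cong C d = mat 1"
    using d by (simp add: diag_cong_mult[OF C] diag_one matrix_transpose_mul[symmetric] matrix_inv_right[OF C])
  then show "diag_cong C d ** (transpose (matrix_inv C) ** diag (\<lambda>i. inverse (d i)) ** matrix_inv C) = mat 1"
    using matrix_left_right_inverse by blast
qed

lemma SPD_invertible: "P \<in> SPD \<Longrightarrow> invertible P"
  unfolding invertible_left_inverse matrix_left_invertible_ker
  using SPD_pos by fastforce

lemma eigenvalues_diag_cong:
  assumes C: "invertible C" and p: "\<And>i. p i > 0"
  shows "eigenvalues (matrix_inv (diag_cong C p) ** diag_cong C q) = range (\<lambda>i. q i / p i)"
proof -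
  define B where "B = transpose (matrix_inv C)"
  have BC: "transpose C ** B = mat 1" "B ** transpose C = mat 1"
    by (simp_all add: B_def matrix_transpose_mul[symmetric] matrix_inv_left[OF C]
        matrix_inv_right[OF C])
  have "matrix_inv (diag_cong C p) ** diag_cong C q = B ** diag (\<lambda>i. inverse (p i) * q i) ** transpose C"
    using p by (simp add: matrix_inv_diag_cong[OF C] diag_cong_mult[OF C] less_imp_neq[symmetric] B_def)
  also have "(\<lambda>i. inverse (p i) * q i) = (\<lambda>i. q i / p i)" by (simp add: field_simps)
  finally have M: "matrix_inv (diag_cong C p) ** diag_cong C q = B ** diag (\<lambda>i. q i / p i) ** transpose C" .
  have diagv: "(diag r *v x) $ i = r i * x $ i" for r :: "'a \<Rightarrow> real" and x i
    by (simp add: diag_def matrix_vector_mult_def if_distrib if_distribR sum.delta cong: if_cong)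
  show ?thesis unfolding M eigenvalues_def
  proof safe
    fix c v assume v: "v \<noteq> 0" and ev: "(B ** diag (\<lambda>i. q i / p i) ** transpose C) *v v = c *\<^sub>R v"
    define u where "u = transpose C *v v"
    have "u \<noteq> 0" using transpose_mult_nonzero[OF C v] by (simp add: u_def)
    then obtain i where i: "u $ i \<noteq> 0" by (metis vec_eq_iff zero_index)
    have "diag (\<lambda>i. q i / p i) *v u = transpose C *v ((B ** diag (\<lambda>i. q i / p i) ** transpose C) *v v)"
      by (simp only: u_def matrix_vector_mul_assoc matrix_mul_assoc BC matrix_mul_lid)
    also have "\<dots> = c *\<^sub>R u" unfolding ev u_def by (rule matrix_vector_mult_scaleR)
    finally have "(q i / p i) * u $ i = c * u $ i" using diagv[of "\<lambda>i. q i / p i" u i] by simp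
    then have "c = q i / p i" using i p[of i] by (simp add: field_simps)
    then show "c \<in> range (\<lambda>i. q i / p i)" by blast
  next
    fix i
    define v where "v = B *v axis i 1"
    have Cv: "transpose C *v v = axis i 1"
      by (simp only: v_def matrix_vector_mul_assoc BC matrix_vector_mul_lid)
    then have "v \<noteq> 0" by (auto simp: axis_eq_0_iff)
    have "(B ** diag (\<lambda>i. q i / p i) ** transpose C) *v v = B *v (diag (\<lambda>i. q i / p i) *v (transpose C *v v))"
      by (simp only: matrix_vector_mul_assoc matrix_mul_assoc)
    also have "\<dots> = B *v ((q i / p i) *\<^sub>R axis i 1)"
      unfolding Cv by (rule arg_cong[of _ _ "(*v) B"]) (simp add: vec_eq_iff diagv axis_def)
    also have "\<dots> = (q i / p i) *\<^sub>R v"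
      unfolding v_def by (rule matrix_vector_mult_scaleR)
    finally show "\<exists>v. v \<noteq> 0 \<and> (B ** diag (\<lambda>i. q i / p i) ** transpose C) *v v = (q i / p i) *\<^sub>R v"
      using \<open>v \<noteq> 0\<close> by blast
  qed
qed

text \<open>
  Applying \<open>f\<close> to the diagonal does not depend on the frame: two frames for the same \<open>P\<close> differ by
  an orthogonal \<open>U\<close>, and \<open>diag s U = U diag s'\<close> says that \<open>s i = s' j\<close> wherever \<open>U i j\<close> is nonzero, so
  that \<open>U\<close> intertwines \<open>f s\<close> and \<open>f s'\<close> as well. With this lemma the midpoint of two matrices can be
  computed in any frame.
\<close>

lemma diag_cong_functional_calculus:
  assumes C: "invertible C" and C': "invertible C'"
    and one: "diag_cong C (\<lambda>_. 1) = diag_cong C' (\<lambda>_. 1)"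
    and s: "diag_cong C s = diag_cong C' s'"
  shows "diag_cong C (\<lambda>i. f (s i)) = diag_cong C' (\<lambda>i. f (s' i))"
proof -
  define U where "U = matrix_inv C ** C'"
  have C'U: "C' = C ** U" by (simp add: U_def matrix_mul_assoc matrix_inv_right[OF C])
  have canc: "X = Y" if "C ** X ** transpose C = C ** Y ** transpose C" for X Y
  proof -
    have "matrix_inv C ** (C ** X ** transpose C) ** transpose (matrix_inv C) =
          matrix_inv C ** (C ** Y ** transpose C) ** transpose (matrix_inv C)" using that by simp
    then have "(matrix_inv C ** C) ** X ** transpose (matrix_inv C ** C) =
          (matrix_inv C ** C) ** Y ** transpose (matrix_inv C ** C)"
      by (simp only: matrix_mul_assoc matrix_transpose_mul)
    then show ?thesis by (simp add: matrix_inv_left[OF C])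
  qed
  have eq: "diag_cong C' d = C ** (U ** diag d ** transpose U) ** transpose C" for d
    by (simp add: diag_cong_def C'U matrix_transpose_mul matrix_mul_assoc)
  have "C ** mat 1 ** transpose C = C ** (U ** transpose U) ** transpose C"
    using one eq[of "\<lambda>_. 1"] by (simp add: diag_cong_def diag_one)
  then have U: "U ** transpose U = mat 1" using canc by metis
  then have U': "transpose U ** U = mat 1" using matrix_left_right_inverse by blast
  have "diag s = U ** diag s' ** transpose U"
    using s eq[of s'] canc by (simp add: diag_cong_def)
  then have "diag s ** U = U ** diag s' ** (transpose U ** U)" by (simp only: matrix_mul_assoc)
  then have "diag s ** U = U ** diag s'" by (simp add: U')
  then have "s i * U $ i $ j = U $ i $ j * s' j" for i j
    using diag_mult_left[of s U i j] diag_mult_right[of U s' i j] by metis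
  then have "U $ i $ j = 0 \<or> s i = s' j" for i j
    by (metis mult.commute mult_cancel_right)
  then have "f (s i) * U $ i $ j = U $ i $ j * f (s' j)" for i j
    by (metis mult.commute mult_zero_left)
  then have "diag (\<lambda>i. f (s i)) ** U = U ** diag (\<lambda>i. f (s' i))"
    by (simp add: vec_eq_iff diag_mult_left diag_mult_right)
  then have "diag (\<lambda>i. f (s i)) = U ** diag (\<lambda>i. f (s' i)) ** transpose U"
    by (metis U matrix_mul_assoc matrix_mul_rid)
  then show ?thesis using eq by (simp add: diag_cong_def)
qed

section \<open>Matrix calculus\<close>

lemma bounded_bilinear_matrix_mult:
  "bounded_bilinear ((**) :: real^'n^'n \<Rightarrow> real^'n^'n \<Rightarrow> real^'n^'n)"
  unfolding bilinear_conv_bounded_bilinear[symmetric] bilinear_def linear_iff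
  by (simp add: vec_eq_iff matrix_matrix_mult_def sum.distrib sum_distrib_left algebra_simps)

lemma bounded_bilinear_matrix_vector_mult:
  "bounded_bilinear ((*v) :: real^'n^'n \<Rightarrow> real^'n \<Rightarrow> real^'n)"
  unfolding bilinear_conv_bounded_bilinear[symmetric] bilinear_def linear_iff
  by (simp add: vec_eq_iff matrix_vector_mult_def sum.distrib sum_distrib_left algebra_simps)

interpretation matmul: bounded_bilinear "(**) :: real^'n^'n \<Rightarrow> real^'n^'n \<Rightarrow> real^'n^'n"
  by (rule bounded_bilinear_matrix_mult)

interpretation matvec: bounded_bilinear "(*v) :: real^'n^'n \<Rightarrow> real^'n \<Rightarrow> real^'n"
  by (rule bounded_bilinear_matrix_vector_mult)

lemma bounded_linear_transpose:
  "bounded_linear (transpose :: real^'n^'n \<Rightarrow> real^'n^'n)"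
  by (intro linear_conv_bounded_linear[THEN iffD1] linearI)
     (simp_all add: vec_eq_iff transpose_def)

lemma bounded_linear_trace: "bounded_linear (trace :: real^'n^'n \<Rightarrow> real)"
  by (intro linear_conv_bounded_linear[THEN iffD1] linearI)
     (simp_all add: trace_def sum.distrib sum_distrib_left)

lemma trace_minus: "trace (- A) = - trace (A :: real^'n^'n)"
  by (simp add: trace_def sum_negf)

lemma trace_scaleR: "trace (c *\<^sub>R A) = c * trace (A :: real^'n^'n)"
  by (simp add: trace_def sum_distrib_left)

lemma has_vector_derivative_iff_quotient:
  "(f has_vector_derivative f') (at x within S) \<longleftrightarrow>
   ((\<lambda>y. (f y - f x) /\<^sub>R (y - x)) \<longlongrightarrow> f') (at x within S)"
proof -
  have eq: "norm (f y - f x - (y - x) *\<^sub>R f') / norm (y - x) = norm ((f y - f x) /\<^sub>R (y - x) - f')"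
    if "y \<noteq> x" for y
  proof -
    have "(f y - f x) /\<^sub>R (y - x) - f' = (f y - f x - (y - x) *\<^sub>R f') /\<^sub>R (y - x)"
      using that by (simp add: scaleR_diff_right)
    then show ?thesis by (simp add: divide_inverse mult.commute)
  qed
  have "(f has_vector_derivative f') (at x within S) \<longleftrightarrow>
      ((\<lambda>y. norm (f y - f x - (y - x) *\<^sub>R f') / norm (y - x)) \<longlongrightarrow> 0) (at x within S)"
    unfolding has_vector_derivative_def has_derivative_iff_norm
    by (simp add: bounded_linear_scaleR_left)
  also have "\<dots> \<longleftrightarrow> ((\<lambda>y. norm ((f y - f x) /\<^sub>R (y - x) - f')) \<longlongrightarrow> 0) (at x within S)"
    by (rule tendsto_cong, unfold eventually_at_filter, intro always_eventually allI impI) (rule eq)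
  also have "\<dots> \<longleftrightarrow> ((\<lambda>y. (f y - f x) /\<^sub>R (y - x)) \<longlongrightarrow> f') (at x within S)"
    by (simp add: tendsto_norm_zero_iff LIM_zero_iff)
  finally show ?thesis .
qed

lemma tendsto_det:
  fixes f :: "'a \<Rightarrow> real^'n^'n"
  assumes "\<And>i j. ((\<lambda>x. f x $ i $ j) \<longlongrightarrow> A $ i $ j) F"
  shows "((\<lambda>x. det (f x)) \<longlongrightarrow> det A) F"
  unfolding det_def by (intro tendsto_intros assms)

lemma matrix_inv_cramer:
  fixes A :: "real^'n^'n"
  assumes "det A \<noteq> 0"
  shows "matrix_inv A $ k $ j =
    det (\<chi> i l. if l = k then (axis j 1 :: real^'n) $ i else A $ i $ l) / det A"
proof -
  have "A *v (matrix_inv A *v axis j 1) = axis j 1"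
    using assms by (simp add: matrix_vector_mul_assoc matrix_inv_right invertible_det_nz)
  then have "(matrix_inv A *v axis j 1) $ k =
    det (\<chi> i l. if l = k then (axis j 1 :: real^'n) $ i else A $ i $ l) / det A"
    unfolding cramer[OF assms] by simp
  then show ?thesis by (simp add: matrix_vector_mult_basis column_def)
qed

text \<open>Continuity of the inverse is read off from Cramer's rule.\<close>

lemma tendsto_matrix_inv:
  fixes f :: "'a \<Rightarrow> real^'n^'n"
  assumes f: "(f \<longlongrightarrow> A) F" and A: "invertible A"
  shows "eventually (\<lambda>x. invertible (f x)) F"
    and "((\<lambda>x. matrix_inv (f x)) \<longlongrightarrow> matrix_inv A) F"
proof -
  have fij: "((\<lambda>x. f x $ i $ j) \<longlongrightarrow> A $ i $ j) F" for i j
    by (intro tendsto_vec_nth f)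
  have A0: "det A \<noteq> 0" using A by (simp add: invertible_det_nz)
  have "((\<lambda>x. det (f x)) \<longlongrightarrow> det A) F" by (rule tendsto_det[OF fij])
  then have ev: "eventually (\<lambda>x. det (f x) \<noteq> 0) F"
    using A0 by (rule tendsto_imp_eventually_ne)
  then show "eventually (\<lambda>x. invertible (f x)) F" by (simp add: invertible_det_nz)
  show "((\<lambda>x. matrix_inv (f x)) \<longlongrightarrow> matrix_inv A) F"
  proof (intro vec_tendstoI)
    fix k j
    let ?M = "\<lambda>A. (\<chi> i l. if l = k then (axis j 1 :: real^'n) $ i else A $ i $ l) :: real^'n^'n"
    have "((\<lambda>x. det (?M (f x)) / det (f x)) \<longlongrightarrow> det (?M A) / det A) F"
      by (intro tendsto_divide tendsto_det A0) (simp_all add: fij)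
    then show "((\<lambda>x. matrix_inv (f x) $ k $ j) \<longlongrightarrow> matrix_inv A $ k $ j) F"
      unfolding matrix_inv_cramer[OF A0]
      by (rule Lim_transform_eventually) (use ev in eventually_elim, simp add: matrix_inv_cramer)
  qed
qed

text \<open>
  The difference quotient of the inverse is \<open>- B\<inverse> ((B - A) / h) A\<inverse>\<close>, so that continuity of the
  inverse already gives differentiability.
\<close>

lemma has_vector_derivative_matrix_inv:
  fixes f :: "real \<Rightarrow> real^'n^'n"
  assumes f: "(f has_vector_derivative f') (at x within S)" and inv: "invertible (f x)"
  shows "((\<lambda>t. matrix_inv (f t)) has_vector_derivative
           - (matrix_inv (f x) ** f' ** matrix_inv (f x))) (at x within S)"
proof -
  have lim: "(f \<longlongrightarrow> f x) (at x within S)"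
    using has_vector_derivative_continuous[OF f] by (simp add: continuous_within)
  note ilim = tendsto_matrix_inv[OF lim inv]
  have quot: "((\<lambda>y. (f y - f x) /\<^sub>R (y - x)) \<longlongrightarrow> f') (at x within S)"
    using f by (simp add: has_vector_derivative_iff_quotient)
  have "((\<lambda>y. - (matrix_inv (f y) ** ((f y - f x) /\<^sub>R (y - x)) ** matrix_inv (f x))) \<longlongrightarrow>
      - (matrix_inv (f x) ** f' ** matrix_inv (f x))) (at x within S)"
    by (intro tendsto_minus matmul.tendsto ilim(2) quot tendsto_const)
  then show ?thesis
    unfolding has_vector_derivative_iff_quotient
  proof (rule Lim_transform_eventually)
    show "eventually (\<lambda>y. - (matrix_inv (f y) ** ((f y - f x) /\<^sub>R (y - x)) ** matrix_inv (f x)) =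
        (matrix_inv (f y) - matrix_inv (f x)) /\<^sub>R (y - x)) (at x within S)"
      using ilim(1)
    proof eventually_elim
      fix y assume y: "invertible (f y)"
      have "matrix_inv (f y) ** (f y - f x) ** matrix_inv (f x) =
          (matrix_inv (f y) ** f y) ** matrix_inv (f x) - matrix_inv (f y) ** (f x ** matrix_inv (f x))"
        by (simp add: matmul.diff_left matmul.diff_right matrix_mul_assoc)
      also have "\<dots> = matrix_inv (f x) - matrix_inv (f y)"
        by (simp add: matrix_inv_left[OF y] matrix_inv_right[OF inv])
      finally show "- (matrix_inv (f y) ** ((f y - f x) /\<^sub>R (y - x)) ** matrix_inv (f x)) =
        (matrix_inv (f y) - matrix_inv (f x)) /\<^sub>R (y - x)"
        by (simp add: matmul.scaleR_left matmul.scaleR_right scaleR_minus_right[symmetric]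
            del: scaleR_minus_right)
    qed
  qed
qed

lemma transpose_matrix_inv_SPD:
  fixes P :: "real^'n^'n"
  assumes "P \<in> SPD"
  shows "transpose (matrix_inv P) = matrix_inv P"
proof -
  have "transpose (matrix_inv P ** P) = mat 1"
    by (simp add: matrix_inv_left[OF SPD_invertible[OF assms]])
  moreover have "transpose P = P" using SPD_imp_Sym[OF assms] by (simp add: Sym_def)
  ultimately have "P ** transpose (matrix_inv P) = mat 1" by (simp add: matrix_transpose_mul)
  then show ?thesis by (metis matrix_inv_eqI)
qed

lemma transpose_add: "transpose (A + B) = transpose A + transpose (B :: real^'n^'n)"
  by (simp add: vec_eq_iff transpose_def)

lemma transpose_minus: "transpose (- A) = - transpose (A :: real^'n^'n)"
  by (simp add: vec_eq_iff transpose_def)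

section \<open>The Levi-Civita connection\<close>

lemma ai_metric_commute: "ai_metric P X Y = ai_metric P Y X"
  unfolding ai_metric_def using trace_mul_sym[of "matrix_inv P ** X" "matrix_inv P ** Y"]
  by (simp only: matrix_mul_assoc)

lemma ai_metric_diff_left: "ai_metric P (X - X') Y = ai_metric P X Y - ai_metric P X' Y"
  by (simp add: ai_metric_def matmul.diff_left matmul.diff_right trace_sub)

text \<open>
  Positive definiteness: if \<open>P = C C\<^sup>T\<close> and \<open>W = C diag(d) C\<^sup>T\<close>, then \<open>P\<inverse> W\<close> is similar to \<open>diag(d)\<close>,
  and the metric at \<open>(W, W)\<close> is the sum of the squares of \<open>d\<close>.
\<close>

lemma ai_metric_zero_imp:
  assumes P: "P \<in> SPD" and W: "W \<in> Sym" and 0: "ai_metric P W W = 0"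
  shows "W = 0"
proof -
  obtain C d where C: "invertible C" and Pd: "P = diag_cong C (\<lambda>_. 1)" and Wd: "W = diag_cong C d"
    using simultaneous_diagonalization[OF P W] .
  define B where "B = transpose (matrix_inv C)"
  have CB: "transpose C ** B = mat 1"
    by (simp add: B_def matrix_transpose_mul[symmetric] matrix_inv_left[OF C])
  have PW: "matrix_inv P ** W = B ** diag d ** transpose C"
    unfolding Pd Wd by (simp add: matrix_inv_diag_cong[OF C] diag_cong_mult[OF C] B_def)
  have "ai_metric P W W = trace ((B ** diag d ** transpose C) ** (B ** diag d ** transpose C))"
    unfolding ai_metric_def PW[symmetric] by (simp only: matrix_mul_assoc)
  also have "(B ** diag d ** transpose C) ** (B ** diag d ** transpose C) =
      B ** (diag d ** (transpose C ** B) ** diag d ** transpose C)"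
    by (simp only: matrix_mul_assoc)
  also have "trace \<dots> = trace (diag d ** diag d ** (transpose C ** B))"
    by (subst trace_mul_sym) (simp add: CB matrix_mul_assoc[symmetric])
  also have "\<dots> = (\<Sum>i\<in>UNIV. d i * d i)"
    by (simp add: CB diag_mult_diag trace_def) (simp add: diag_def)
  finally have "(\<Sum>i\<in>UNIV. d i * d i) = 0" using 0 by simp
  then have "d i = 0" for i by (subst (asm) sum_nonneg_eq_0_iff) auto
  then have "diag d = 0" by (simp add: diag_def vec_eq_iff)
  then show ?thesis by (simp add: Wd diag_cong_def matmul.zero_left matmul.zero_right)
qed

definition ai_christoffel :: "('n::finite) christoffel" where
  "ai_christoffel P X Y = (- 1 / 2) *\<^sub>R (X ** matrix_inv P ** Y + Y ** matrix_inv P ** X)"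

text \<open>
  The derivative of the metric along \<open>Z\<close> consists of two traces with the six factors
  \<open>J Z J X J Y\<close> and \<open>J X J Z J Y\<close>, where \<open>J = P\<inverse>\<close>. By cyclicity of the trace each of the two terms on
  the right contributes half of their sum.
\<close>

lemma is_levi_civita_ai_christoffel: "is_levi_civita (ai_christoffel :: ('n::finite) christoffel)"
  unfolding is_levi_civita_def
proof (intro ballI conjI)
  fix P :: "real^'n^'n" assume P: "P \<in> SPD"
  show "bilinear (ai_christoffel P)"
    unfolding bilinear_def linear_iff ai_christoffel_def
    by (simp add: matmul.add_left matmul.add_right matmul.scaleR_left matmul.scaleR_right algebra_simps)
next
  fix P X Y :: "real^'n^'n" assume P: "P \<in> SPD" and X: "X \<in> Sym" and Y: "Y \<in> Sym"
  show "ai_christoffel P X Y = ai_christoffel P Y X"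
    by (simp add: ai_christoffel_def add.commute)
  show "ai_christoffel P X Y \<in> Sym"
    using X Y transpose_matrix_inv_SPD[OF P]
    by (simp add: Sym_def ai_christoffel_def transpose_scalar transpose_add transpose_minus matrix_transpose_mul
        matrix_mul_assoc add.commute)
next
  fix P X Y Z :: "real^'n^'n"
  assume P: "P \<in> SPD" and X: "X \<in> Sym" and Y: "Y \<in> Sym" and Z: "Z \<in> Sym"
  define J where "J = matrix_inv P"
  have "((\<lambda>t. P + t *\<^sub>R Z) has_vector_derivative Z) (at 0)"
    by (auto intro!: derivative_eq_intros)
  from has_vector_derivative_matrix_inv[OF this]
  have J': "((\<lambda>t. matrix_inv (P + t *\<^sub>R Z)) has_vector_derivative - (J ** Z ** J)) (at 0)"
    using SPD_invertible[OF P] by (simp add: J_def)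
  have JX: "((\<lambda>t. matrix_inv (P + t *\<^sub>R Z) ** X) has_vector_derivative - (J ** Z ** J ** X)) (at 0)"
    for X :: "real^'n^'n"
    using bounded_linear.has_vector_derivative[OF matmul.bounded_linear_left[of X] J']
    by (simp add: matmul.zero_right matmul.minus_left)
  have "((\<lambda>t. (matrix_inv (P + t *\<^sub>R Z) ** X) ** (matrix_inv (P + t *\<^sub>R Z) ** Y)) has_vector_derivative
      (J ** X) ** (- (J ** Z ** J ** Y)) + (- (J ** Z ** J ** X)) ** (J ** Y)) (at 0)"
    using matmul.has_vector_derivative[OF JX[of X] JX[of Y]] by (simp add: J_def)
  from bounded_linear.has_vector_derivative[OF bounded_linear_trace this]
  have D: "((\<lambda>t. ai_metric (P + t *\<^sub>R Z) X Y) has_real_derivative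
      (- trace (J ** X ** J ** Z ** J ** Y) - trace (J ** Z ** J ** X ** J ** Y))) (at 0)"
    by (simp add: has_real_derivative_iff_has_vector_derivative ai_metric_def matrix_mul_assoc
        matmul.minus_left matmul.minus_right trace_sub trace_minus)
  have "trace (J ** X ** J ** Y ** J ** Z) = trace ((J ** X ** J ** Y) ** (J ** Z))"
    by (simp only: matrix_mul_assoc)
  also have "\<dots> = trace (J ** Z ** J ** X ** J ** Y)"
    by (subst trace_mul_sym) (simp only: matrix_mul_assoc)
  finally have cyc: "trace (J ** X ** J ** Y ** J ** Z) = trace (J ** Z ** J ** X ** J ** Y)" .
  have "ai_metric P (ai_christoffel P Z X) Y + ai_metric P X (ai_christoffel P Z Y) =
      - trace (J ** X ** J ** Z ** J ** Y) - trace (J ** Z ** J ** X ** J ** Y)"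
    unfolding ai_metric_def ai_christoffel_def J_def[symmetric]
    by (simp add: matmul.add_left matmul.add_right matmul.scaleR_left matmul.scaleR_right
        matmul.minus_left matmul.minus_right trace_minus
        trace_add trace_scaleR matrix_mul_assoc cyc) (simp add: field_simps)
  with D show "((\<lambda>t. ai_metric (P + t *\<^sub>R Z) X Y) has_real_derivative
      (ai_metric P (ai_christoffel P Z X) Y + ai_metric P X (ai_christoffel P Z Y))) (at 0)"
    by simp
qed

text \<open>
  The Koszul argument: the difference of two Levi-Civita connections, lowered by the metric, is
  symmetric in its first two arguments and skew in its last two, and a trilinear form with both
  properties vanishes.
\<close>

lemma levi_civita_unique:
  assumes G: "is_levi_civita \<Gamma>" and H: "is_levi_civita \<Gamma>'"
    and P: "P \<in> SPD" and X: "X \<in> Sym" and Y: "Y \<in> Sym"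
  shows "\<Gamma> P X Y = \<Gamma>' P X Y"
proof -
  define T where "T X Y = \<Gamma> P X Y - \<Gamma>' P X Y" for X Y
  have T_Sym: "T X Y \<in> Sym" if "X \<in> Sym" "Y \<in> Sym" for X Y
  proof -
    have "\<Gamma> P X Y \<in> Sym" "\<Gamma>' P X Y \<in> Sym"
      using G H P that by (auto simp: is_levi_civita_def)
    then show ?thesis by (simp add: T_def Sym_def vec_eq_iff transpose_def)
  qed
  have T_comm: "T X Y = T Y X" if "X \<in> Sym" "Y \<in> Sym" for X Y
  proof -
    have "\<Gamma> P X Y = \<Gamma> P Y X" "\<Gamma>' P X Y = \<Gamma>' P Y X"
      using G H P that by (auto simp: is_levi_civita_def)
    then show ?thesis by (simp add: T_def)
  qed
  define \<tau> where "\<tau> X Y Z = ai_metric P (T X Y) Z" for X Y Z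
  have anti: "\<tau> Z X Y = - \<tau> Z Y X" if "X \<in> Sym" "Y \<in> Sym" "Z \<in> Sym" for X Y Z
  proof -
    have "((\<lambda>t. ai_metric (P + t *\<^sub>R Z) X Y) has_real_derivative
              (ai_metric P (\<Gamma> P Z X) Y + ai_metric P X (\<Gamma> P Z Y))) (at 0)"
      "((\<lambda>t. ai_metric (P + t *\<^sub>R Z) X Y) has_real_derivative
              (ai_metric P (\<Gamma>' P Z X) Y + ai_metric P X (\<Gamma>' P Z Y))) (at 0)"
      using G H P that by (auto simp: is_levi_civita_def)
    from DERIV_unique[OF this] show ?thesis
      unfolding \<tau>_def T_def ai_metric_diff_left by (simp add: ai_metric_commute[of P X])
  qed
  have comm: "\<tau> X Y Z = \<tau> Y X Z" if "X \<in> Sym" "Y \<in> Sym" for X Y Z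
    using T_comm[OF that] by (simp add: \<tau>_def)
  define W where "W = T X Y"
  have W: "W \<in> Sym" using T_Sym X Y by (simp add: W_def)
  have "\<tau> X Y W = - \<tau> X W Y" by (rule anti[OF Y W X])
  also have "\<tau> X W Y = \<tau> W X Y" by (rule comm[OF X W])
  also have "\<tau> W X Y = - \<tau> W Y X" by (rule anti[OF X Y W])
  also have "\<tau> W Y X = \<tau> Y W X" by (rule comm[OF W Y])
  also have "\<tau> Y W X = - \<tau> Y X W" by (rule anti[OF W X Y])
  also have "\<tau> Y X W = \<tau> X Y W" by (rule comm[OF Y X])
  finally have "ai_metric P W W = - ai_metric P W W" by (simp add: \<tau>_def W_def)
  then have "ai_metric P W W = 0" by simp
  from ai_metric_zero_imp[OF P W this] show ?thesis by (simp add: W_def T_def)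
qed

lemma alpha_connection_self:
  fixes P X :: "real^'n^'n"
  assumes "P \<in> SPD" "X \<in> Sym"
  shows "alpha_connection \<beta> P X X = - ((1 - \<beta>) *\<^sub>R (X ** matrix_inv P ** X))"
proof -
  have "is_levi_civita (levi_civita_connection :: 'n christoffel)"
    unfolding levi_civita_connection_def by (rule someI[of is_levi_civita, OF is_levi_civita_ai_christoffel])
  from levi_civita_unique[OF this is_levi_civita_ai_christoffel assms(1,2,2)]
  have "levi_civita_connection P X X = - (X ** matrix_inv P ** X)"
    by (simp add: ai_christoffel_def scaleR_add_right scaleR_add_left[symmetric])
  then show ?thesis
    by (simp add: alpha_connection_def euclidean_connection_def scaleR_diff_left)
qed

section \<open>Geodesics of the \<open>\<alpha>\<close>-connections\<close>

lemma has_vector_derivative_diag_cong: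
  fixes f :: "real \<Rightarrow> 'n::finite \<Rightarrow> real"
  assumes "\<And>i. ((\<lambda>t. f t i) has_real_derivative f' i) (at t within S)"
  shows "((\<lambda>t. diag_cong C (f t)) has_vector_derivative diag_cong C f') (at t within S)"
proof -
  \<comment> \<open>\<open>diag_cong C\<close> is linear in the diagonal, with the rank-one matrices of the columns of \<open>C\<close> as coefficients\<close>
  have ex: "diag_cong C d = (\<Sum>i\<in>UNIV. d i *\<^sub>R (\<chi> k l. C $ k $ i * C $ l $ i))" for d
  proof -
    have "diag_cong C d $ k $ l = (\<Sum>i\<in>UNIV. d i * (C $ k $ i * C $ l $ i))" for k l
    proof -
      have "diag_cong C d $ k $ l = (\<Sum>i\<in>UNIV. (C ** diag d) $ k $ i * transpose C $ i $ l)"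
        by (simp add: diag_cong_def matrix_matrix_mult_def[of "C ** diag d"])
      also have "\<dots> = (\<Sum>i\<in>UNIV. d i * (C $ k $ i * C $ l $ i))"
        by (simp add: diag_mult_right transpose_def mult_ac)
      finally show ?thesis .
    qed
    then show ?thesis by (simp add: vec_eq_iff)
  qed
  show ?thesis unfolding ex
    by (intro has_vector_derivative_sum)
       (rule bounded_linear.has_vector_derivative[OF bounded_linear_scaleR_left
          assms[unfolded has_real_derivative_iff_has_vector_derivative]])
qed

text \<open>
  Gronwall's argument: \<open>\<parallel>w\<parallel>\<^sup>2\<close> grows at rate at most \<open>2 L\<close>, so \<open>exp (- 2 L t) \<parallel>w t\<parallel>\<^sup>2\<close> is
  nonincreasing and stays at its initial value \<open>0\<close>.
\<close>

lemma linear_ode_zero_unique: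
  fixes w :: "real \<Rightarrow> real^'n"
  assumes w: "\<And>t. t \<in> {0..1} \<Longrightarrow> (w has_vector_derivative A t *v w t) (at t within {0..1})"
    and A: "continuous_on {0..1} A" and w0: "w 0 = 0" and t: "t \<in> {0..1}"
  shows "w t = 0"
proof -
  have "compact (A ` {0..1})" by (intro compact_continuous_image A) simp
  then obtain M where M: "\<And>t. t \<in> {0..1} \<Longrightarrow> norm (A t) \<le> M"
    using compact_imp_bounded bounded_iff by (metis imageI)
  obtain K where K: "\<And>(B::real^'n^'n) x. norm (B *v x) \<le> norm B * norm x * K" and "K > 0"
    using matvec.pos_bounded by metis
  define L where "L = M * K"
  have bd: "w t \<bullet> (A t *v w t) \<le> L * (w t \<bullet> w t)" if "t \<in> {0..1}" for t
  proof -
    have "w t \<bullet> (A t *v w t) \<le> norm (w t) * norm (A t *v w t)"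
      by (rule norm_cauchy_schwarz)
    also have "\<dots> \<le> norm (w t) * (norm (A t) * norm (w t) * K)"
      by (intro mult_left_mono K) auto
    also have "\<dots> \<le> norm (w t) * (M * norm (w t) * K)"
      using \<open>K > 0\<close> by (intro mult_left_mono mult_right_mono M that) auto
    also have "\<dots> = L * (w t \<bullet> w t)" by (simp add: L_def dot_square_norm power2_eq_square)
    finally show ?thesis .
  qed
  define g where "g t = exp (- (2 * L * t)) * (w t \<bullet> w t)" for t
  have gd: "(g has_real_derivative exp (- (2 * L * t)) * (2 * (w t \<bullet> (A t *v w t)) - 2 * L * (w t \<bullet> w t)))
      (at t within {0..1})" if t: "t \<in> {0..1}" for t
  proof -
    have "((\<lambda>t. w t \<bullet> w t) has_vector_derivative w t \<bullet> (A t *v w t) + (A t *v w t) \<bullet> w t) (at t within {0..1})"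
      by (rule bounded_bilinear.has_vector_derivative[OF bounded_bilinear_inner w[OF t] w[OF t]])
    then have *: "((\<lambda>t. w t \<bullet> w t) has_real_derivative 2 * (w t \<bullet> (A t *v w t))) (at t within {0..1})"
      by (simp add: has_real_derivative_iff_has_vector_derivative inner_commute)
    show ?thesis unfolding g_def
      by (rule derivative_eq_intros * refl)+ (simp add: algebra_simps)
  qed
  have "g t \<le> g 0"
  proof -
    have "\<exists>x\<in>{0..t}. g t - g 0 =
        (\<lambda>h. exp (- (2 * L * x)) * (2 * (w x \<bullet> (A x *v w x)) - 2 * L * (w x \<bullet> w x)) * h) (t - 0)"
    proof (rule mvt_very_simple)
      fix x assume x: "0 \<le> x" "x \<le> t"
      then have "x \<in> {0..1}" and sub: "{0..t} \<subseteq> {0..1}" using t by auto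
      from has_field_derivative_subset[OF gd[OF this(1)] sub]
      show "(g has_derivative (*) (exp (- (2 * L * x)) * (2 * (w x \<bullet> (A x *v w x)) - 2 * L * (w x \<bullet> w x))))
          (at x within {0..t})"
        by (simp add: has_field_derivative_def)
    qed (use t in auto)
    then obtain x where x: "x \<in> {0..t}" and
      eq: "g t - g 0 = exp (- (2 * L * x)) * (2 * (w x \<bullet> (A x *v w x)) - 2 * L * (w x \<bullet> w x)) * t"
      by auto
    have "2 * (w x \<bullet> (A x *v w x)) - 2 * L * (w x \<bullet> w x) \<le> 0"
      using bd[of x] x t by auto
    then have "exp (- (2 * L * x)) * (2 * (w x \<bullet> (A x *v w x)) - 2 * L * (w x \<bullet> w x)) * t \<le> 0"
      using t by (intro mult_nonpos_nonneg mult_nonneg_nonpos) auto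
    with eq show ?thesis by simp
  qed
  moreover have "g 0 = 0" by (simp add: g_def w0)
  ultimately have "w t \<bullet> w t \<le> 0" by (simp add: g_def mult_le_0_iff not_le)
  then have "w t \<bullet> w t = 0" using inner_ge_zero[of "w t"] by linarith
  then show ?thesis by simp
qed

lemma diag_cong_mult_basis:
  assumes C: "invertible C"
  shows "diag_cong C d *v (transpose (matrix_inv C) *v axis i 1) = d i *\<^sub>R (C *v axis i 1)"
proof -
  have CB: "transpose C ** transpose (matrix_inv C) = mat 1"
    by (simp add: matrix_transpose_mul[symmetric] matrix_inv_left[OF C])
  have "diag_cong C d *v (transpose (matrix_inv C) *v axis i 1) =
      C *v (diag d *v ((transpose C ** transpose (matrix_inv C)) *v axis i 1))"
    by (simp only: diag_cong_def matrix_vector_mul_assoc matrix_mul_assoc)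
  also have "diag d *v ((transpose C ** transpose (matrix_inv C)) *v axis i 1) = d i *\<^sub>R axis i 1"
    unfolding CB matrix_vector_mul_lid
    by (subst matrix_vector_mult_basis) (simp add: vec_eq_iff diag_def column_def axis_def)
  finally show ?thesis by (simp add: matvec.scaleR_right)
qed

lemma matrix_eq_on_basis:
  fixes A A' B :: "real^'n^'n"
  assumes B: "invertible B" and eq: "\<And>i. A *v (B *v axis i 1) = A' *v (B *v axis i 1)"
  shows "A = A'"
proof -
  have "column i (A ** B) = column i (A' ** B)" for i
    using eq[of i] unfolding matrix_vector_mul_assoc by (simp only: matrix_vector_mult_basis)
  then have "A ** B = A' ** B" by (simp add: vec_eq_iff column_def)
  then have "A ** B ** matrix_inv B = A' ** B ** matrix_inv B" by simp
  then show ?thesis by (simp add: matrix_mul_assoc[symmetric] matrix_inv_right[OF B])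
qed

text \<open>
  The geodesic equation is \<open>\<gamma>'' = (1 - \<beta>) \<gamma>' \<gamma>\<inverse> \<gamma>'\<close>, so \<open>U = \<gamma>\<inverse> \<gamma>'\<close> satisfies \<open>U' = - \<beta> U\<^sup>2\<close>. Let \<open>v\<close>
  be a generalized eigenvector of \<open>(\<gamma>' 0, \<gamma> 0)\<close> for the eigenvalue \<open>d\<close>, that is, \<open>U 0 v = d v\<close>. The
  expected solution \<open>U t v = (d / (1 + \<beta> t d)) v\<close> is verified by multiplying out the denominator,
  because the defect then solves a homogeneous linear equation; this also shows that the denominator
  cannot vanish, and so \<open>1 + \<beta> t d\<close> stays positive as long as the geodesic exists. Finally
  \<open>\<gamma>' v = \<gamma> U v\<close> is a scalar linear equation for \<open>\<gamma> v\<close>.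
\<close>

lemma geodesic_closed_form:
  fixes \<gamma> :: "real \<Rightarrow> real^'n^'n"
  assumes \<beta>: "\<beta> \<noteq> 0" and geo: "is_geodesic (alpha_connection \<beta>) \<gamma>"
  obtains C d where "invertible C"
    "\<And>t i. t \<in> {0..1} \<Longrightarrow> 1 + \<beta> * t * d i > 0"
    "\<And>t. t \<in> {0..1} \<Longrightarrow> \<gamma> t = diag_cong C (\<lambda>i. (1 + \<beta> * t * d i) powr (1 / \<beta>))"
proof -
  have S: "\<And>t. t \<in> {0..1} \<Longrightarrow> \<gamma> t \<in> SPD" using geo by (simp add: is_geodesic_def)
  obtain \<gamma>' where
    D1: "\<And>t. t \<in> {0..1} \<Longrightarrow> (\<gamma> has_vector_derivative \<gamma>' t) (at t within {0..1})" and
    D2': "\<And>t. t \<in> {0..1} \<Longrightarrow> (\<gamma>' has_vector_derivative - alpha_connection \<beta> (\<gamma> t) (\<gamma>' t) (\<gamma>' t)) (at t within {0..1})"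
    using geo unfolding is_geodesic_def by blast
  have Sym': "\<gamma>' t \<in> Sym" if t: "t \<in> {0..1}" for t
  proof -
    have "((\<lambda>t. transpose (\<gamma> t)) has_vector_derivative transpose (\<gamma>' t)) (at t within {0..1})"
      by (rule bounded_linear.has_vector_derivative[OF bounded_linear_transpose D1[OF t]])
    then have "(\<gamma> has_vector_derivative transpose (\<gamma>' t)) (at t within {0..1})"
    proof (rule has_vector_derivative_transform[OF t, rotated])
      show "\<gamma> x = transpose (\<gamma> x)" if "x \<in> {0..1}" for x
        using SPD_imp_Sym[OF S[OF that]] by (simp add: Sym_def)
    qed
    then have "transpose (\<gamma>' t) = \<gamma>' t"
      using vector_derivative_unique_within_closed_interval[of 0 1 t \<gamma>] D1[OF t] t by simp
    then show ?thesis by (simp add: Sym_def)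
  qed
  define J where "J t = matrix_inv (\<gamma> t)" for t
  have \<gamma>J: "\<gamma> t ** J t = mat 1" "J t ** \<gamma> t = mat 1" if "t \<in> {0..1}" for t
    using matrix_inv_left matrix_inv_right SPD_invertible[OF S[OF that]] by (auto simp: J_def)
  have D2: "(\<gamma>' has_vector_derivative (1 - \<beta>) *\<^sub>R (\<gamma>' t ** J t ** \<gamma>' t)) (at t within {0..1})"
    if t: "t \<in> {0..1}" for t
    using D2'[OF t] alpha_connection_self[OF S[OF t] Sym'[OF t], of \<beta>] by (simp add: J_def)
  define U where "U t = J t ** \<gamma>' t" for t
  have U': "(U has_vector_derivative - (\<beta> *\<^sub>R (U t ** U t))) (at t within {0..1})" if t: "t \<in> {0..1}" for t
  proof -
    have "(J has_vector_derivative - (J t ** \<gamma>' t ** J t)) (at t within {0..1})"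
      unfolding J_def by (rule has_vector_derivative_matrix_inv[OF D1[OF t] SPD_invertible[OF S[OF t]]])
    from matmul.has_vector_derivative[OF this D2[OF t]]
    have "(U has_vector_derivative (J t ** ((1 - \<beta>) *\<^sub>R (\<gamma>' t ** J t ** \<gamma>' t))
        + (- (J t ** \<gamma>' t ** J t)) ** \<gamma>' t)) (at t within {0..1})"
      by (simp add: U_def[abs_def])
    also have "J t ** ((1 - \<beta>) *\<^sub>R (\<gamma>' t ** J t ** \<gamma>' t)) + (- (J t ** \<gamma>' t ** J t)) ** \<gamma>' t =
        - (\<beta> *\<^sub>R (U t ** U t))"
      by (simp add: U_def matmul.scaleR_right matmul.minus_left matmul.diff_right matrix_mul_assoc scaleR_diff_left)
    finally show ?thesis .
  qed
  have contU: "continuous_on {0..1} U"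
    unfolding continuous_on_eq_continuous_within using has_vector_derivative_continuous[OF U'] by blast
  have 0: "(0::real) \<in> {0..1}" by simp
  obtain C d where C: "invertible C" and P: "\<gamma> 0 = diag_cong C (\<lambda>_. 1)" and X: "\<gamma>' 0 = diag_cong C d"
    using simultaneous_diagonalization[OF S[OF 0] Sym'[OF 0]] .
  define B where "B = transpose (matrix_inv C)"
  define v where "v i = B *v (axis i 1 :: real^'n)" for i
  have iB: "invertible B"
    unfolding B_def using C by (metis invertible_left_inverse invertible_def matrix_inv_right transpose_invertible)
  have v0: "v i \<noteq> 0" for i
  proof
    assume "v i = 0"
    then have "B *v axis i 1 = B *v 0" by (simp add: v_def)
    then have "axis i (1::real) = 0" using inj_matrix_vector_mult[OF iB] by (metis injD)
    then show False by (simp add: axis_eq_0_iff)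
  qed
  have Pv: "\<gamma> 0 *v v i = C *v axis i 1" and Xv: "\<gamma>' 0 *v v i = d i *\<^sub>R (C *v axis i 1)" for i
    unfolding P X v_def B_def by (simp_all add: diag_cong_mult_basis[OF C] del: transpose_matrix_vector)
  have U0: "U 0 *v v i = d i *\<^sub>R v i" for i
  proof -
    have "U 0 *v v i = J 0 *v (\<gamma>' 0 *v v i)" by (simp add: U_def matrix_vector_mul_assoc)
    also have "\<dots> = d i *\<^sub>R (J 0 *v (\<gamma> 0 *v v i))" by (simp add: Xv Pv matvec.scaleR_right)
    also have "\<dots> = d i *\<^sub>R v i" by (simp add: matrix_vector_mul_assoc \<gamma>J)
    finally show ?thesis .
  qed
  define f where "f i t = 1 + \<beta> * t * d i" for i t
  have fd: "((\<lambda>t. f i t) has_real_derivative \<beta> * d i) (at t within {0..1})" for i t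
    unfolding f_def by (auto intro!: derivative_eq_intros)
  have key: "f i t *\<^sub>R (U t *v v i) = d i *\<^sub>R v i" if t: "t \<in> {0..1}" for i t
  proof -
    \<comment> \<open>the defect of \<open>U t v = (d / f t) v\<close>, which satisfies \<open>w' = - \<beta> U w\<close>\<close>
    define w where "w t = f i t *\<^sub>R (U t *v v i) - d i *\<^sub>R v i" for t
    have "w t = 0"
    proof (rule linear_ode_zero_unique[where A = "\<lambda>t. - (\<beta> *\<^sub>R U t)", OF _ _ _ t])
      show "continuous_on {0..1} (\<lambda>t. - (\<beta> *\<^sub>R U t))" by (intro continuous_intros contU)
      show "w 0 = 0" by (simp add: w_def f_def U0)
      fix t :: real assume t: "t \<in> {0..1}"
      have "((\<lambda>t. U t *v v i) has_vector_derivative (- (\<beta> *\<^sub>R (U t ** U t))) *v v i) (at t within {0..1})"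
        by (rule bounded_linear.has_vector_derivative[OF matvec.bounded_linear_left U'[OF t]])
      from has_vector_derivative_diff[OF has_vector_derivative_scaleR[OF fd[of i] this]
          has_vector_derivative_const[of "d i *\<^sub>R v i"]]
      have "(w has_vector_derivative f i t *\<^sub>R ((- (\<beta> *\<^sub>R (U t ** U t))) *v v i) + (\<beta> * d i) *\<^sub>R (U t *v v i)) (at t within {0..1})"
        by (simp add: w_def[abs_def])
      also have "f i t *\<^sub>R ((- (\<beta> *\<^sub>R (U t ** U t))) *v v i) + (\<beta> * d i) *\<^sub>R (U t *v v i) = - (\<beta> *\<^sub>R U t) *v w t"
        by (simp add: w_def matvec.minus_left matvec.scaleR_left matvec.diff_right matvec.scaleR_right
            matrix_vector_mul_assoc[symmetric] scaleR_diff_right mult.commute)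
      finally show "(w has_vector_derivative - (\<beta> *\<^sub>R U t) *v w t) (at t within {0..1})" .
    qed
    then show ?thesis by (simp add: w_def)
  qed
  have f_nz: "f i t \<noteq> 0" if t: "t \<in> {0..1}" for i t
  proof
    assume z: "f i t = 0"
    with key[OF t, of i] v0 have "d i = 0" by auto
    with z show False by (simp add: f_def)
  qed
  have f_pos: "f i t > 0" if t: "t \<in> {0..1}" for i t
  proof (rule ccontr)
    assume "\<not> f i t > 0"
    then have neg: "f i t < 0" using f_nz[OF t, of i] by linarith
    \<comment> \<open>the zero of the affine function \<open>f i\<close> between \<open>0\<close>, where its value is \<open>1\<close>, and \<open>t\<close>\<close>
    define s where "s = t / (1 - f i t)"
    have s01: "s \<in> {0..1}" using neg t by (simp add: s_def divide_le_eq)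
    have "f i s = 1 + (\<beta> * t * d i) / (1 - f i t)" by (simp add: f_def s_def)
    also have "\<beta> * t * d i = f i t - 1" by (simp add: f_def)
    also have "1 + (f i t - 1) / (1 - f i t) = 0" using neg by (simp add: field_simps)
    finally show False using f_nz[OF s01] by simp
  qed
  have sol: "\<gamma> t *v v i = (f i t powr (1 / \<beta>)) *\<^sub>R (C *v axis i 1)" if t: "t \<in> {0..1}" for i t
  proof -
    \<comment> \<open>integrating factor for \<open>(\<gamma> v)' = (d / f) \<gamma> v\<close>, as \<open>f' = \<beta> d\<close>\<close>
    define z where "z t = (f i t powr (- 1 / \<beta>)) *\<^sub>R (\<gamma> t *v v i)" for t
    have "(z has_vector_derivative 0) (at t within {0..1})" if t: "t \<in> {0..1}" for t
    proof -
      have "\<gamma>' t *v v i = \<gamma> t *v (U t *v v i)"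
        by (simp add: U_def matrix_vector_mul_assoc matrix_mul_assoc \<gamma>J[OF t])
      also have "U t *v v i = (d i / f i t) *\<^sub>R v i"
      proof -
        have "(1 / f i t) *\<^sub>R (f i t *\<^sub>R (U t *v v i)) = (1 / f i t) *\<^sub>R (d i *\<^sub>R v i)"
          by (simp only: key[OF t])
        then show ?thesis using f_pos[OF t, of i] by simp
      qed
      finally have gv: "\<gamma>' t *v v i = (d i / f i t) *\<^sub>R (\<gamma> t *v v i)" by (simp add: matvec.scaleR_right)
      have a: "((\<lambda>t. f i t powr (- 1 / \<beta>)) has_real_derivative
          - (d i / f i t) * f i t powr (- 1 / \<beta>)) (at t within {0..1})"
        by (rule DERIV_cong[OF DERIV_chain2[OF has_real_derivative_powr[OF f_pos[OF t]] fd]])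
          (use f_pos[OF t, of i] \<beta> in \<open>simp add: powr_diff\<close>)
      have b: "((\<lambda>t. \<gamma> t *v v i) has_vector_derivative \<gamma>' t *v v i) (at t within {0..1})"
        by (rule bounded_linear.has_vector_derivative[OF matvec.bounded_linear_left D1[OF t]])
      show ?thesis unfolding z_def[abs_def]
        by (rule has_vector_derivative_eq_rhs[OF has_vector_derivative_scaleR[OF a b]])
          (simp add: gv)
    qed
    from has_vector_derivative_zero_constant[OF convex_real_interval(5) this]
    obtain c where "\<And>t. t \<in> {0..1} \<Longrightarrow> z t = c" by blast
    then have "z t = z 0" using t by simp
    also have "z 0 = C *v axis i 1" by (simp add: z_def f_def Pv)
    finally have "(f i t powr (1 / \<beta>)) *\<^sub>R z t = (f i t powr (1 / \<beta>)) *\<^sub>R (C *v axis i 1)" by simp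
    then show ?thesis using f_pos[OF t, of i] by (simp add: z_def powr_add[symmetric])
  qed
  show ?thesis
  proof
    show "invertible C" by (rule C)
    show "1 + \<beta> * t * d i > 0" if "t \<in> {0..1}" for t i
      using f_pos[OF that, of i] by (simp add: f_def)
    fix t :: real assume t: "t \<in> {0..1}"
    show "\<gamma> t = diag_cong C (\<lambda>i. (1 + \<beta> * t * d i) powr (1 / \<beta>))"
    proof (rule matrix_eq_on_basis[OF iB])
      fix i
      show "\<gamma> t *v (B *v axis i 1) = diag_cong C (\<lambda>i. (1 + \<beta> * t * d i) powr (1 / \<beta>)) *v (B *v axis i 1)"
        using sol[OF t, of i] by (simp add: v_def B_def diag_cong_mult_basis[OF C] f_def del: transpose_matrix_vector)
    qed
  qed
qed

lemma diag_cong_quadratic: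
  assumes C: "invertible C" and b: "\<And>i. b i \<noteq> 0"
  shows "diag_cong C a ** matrix_inv (diag_cong C b) ** diag_cong C a = diag_cong C (\<lambda>i. a i * a i / b i)"
proof -
  have CB: "transpose C ** transpose (matrix_inv C) = mat 1"
    by (simp add: matrix_transpose_mul[symmetric] matrix_inv_left[OF C])
  have "diag_cong C a ** matrix_inv (diag_cong C b) ** diag_cong C a =
     diag_cong C a ** (matrix_inv (diag_cong C b) ** diag_cong C a)" by (simp only: matrix_mul_assoc)
  also have "\<dots> = C ** diag a ** (transpose C ** transpose (matrix_inv C)) ** diag (\<lambda>i. inverse (b i) * a i) ** transpose C"
    unfolding matrix_inv_diag_cong[OF C b] diag_cong_mult[OF C] by (simp only: diag_cong_def matrix_mul_assoc)
  also have "\<dots> = C ** (diag a ** diag (\<lambda>i. inverse (b i) * a i)) ** transpose C"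
    by (simp only: CB matrix_mul_rid matrix_mul_assoc)
  finally show ?thesis by (simp add: diag_mult_diag diag_cong_def field_simps)
qed

lemma is_geodesic_power_curve:
  fixes C :: "real^'n^'n"
  assumes \<beta>: "\<beta> \<noteq> 0" and C: "invertible C" and s: "\<And>i. s i > 0"
  shows "is_geodesic (alpha_connection \<beta>)
    (\<lambda>t. diag_cong C (\<lambda>i. (1 + t * (s i powr \<beta> - 1)) powr (1 / \<beta>)))"
proof -
  define c where "c i = s i powr \<beta> - 1" for i
  define h where "h i t = 1 + t * c i" for i t
  have h: "h i t > 0" if "t \<in> {0..1}" for i t
  proof -
    have "h i t = (1 - t) + t * s i powr \<beta>" by (simp add: h_def c_def algebra_simps)
    also have "\<dots> > 0" using that s[of i]
      by (cases "t = 0") (auto intro: add_nonneg_pos)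
    finally show ?thesis .
  qed
  have hd: "(h i has_real_derivative c i) (at t within {0..1})" for i t
    unfolding h_def[abs_def] by (auto intro!: derivative_eq_intros)
  define g where "g t i = h i t powr (1 / \<beta>)" for t i
  define g1 where "g1 t i = (c i / \<beta>) * h i t powr (1 / \<beta> - 1)" for t i
  have pd: "((\<lambda>t. h i t powr r) has_real_derivative r * h i t powr (r - 1) * c i) (at t within {0..1})"
    if t: "t \<in> {0..1}" for t i r
    by (rule DERIV_chain2[OF has_real_derivative_powr[OF h[OF t]] hd])
  have D1: "((\<lambda>t. g t i) has_real_derivative g1 t i) (at t within {0..1})" if t: "t \<in> {0..1}" for t i
    unfolding g_def g1_def by (rule DERIV_cong[OF pd[OF t]]) simp
  have D2: "((\<lambda>t. g1 t i) has_real_derivative (1 - \<beta>) * (g1 t i * g1 t i / g t i)) (at t within {0..1})"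
    if t: "t \<in> {0..1}" for t i
  proof -
    have p: "h i t powr (1 / \<beta> - 1) = g t i / h i t" "h i t powr (1 / \<beta> - 1 - 1) = g t i / h i t / h i t"
      "g t i > 0"
      using h[OF t, of i] by (simp_all add: g_def powr_diff power2_eq_square)
    have "((\<lambda>t. g1 t i) has_real_derivative
        (c i / \<beta>) * ((1 / \<beta> - 1) * h i t powr (1 / \<beta> - 1 - 1) * c i)) (at t within {0..1})"
      unfolding g1_def by (rule DERIV_cmult[OF pd[OF t]])
    also have "(c i / \<beta>) * ((1 / \<beta> - 1) * h i t powr (1 / \<beta> - 1 - 1) * c i) =
        (1 - \<beta>) * (g1 t i * g1 t i / g t i)"
      unfolding g1_def p using p(3) h[OF t, of i] \<beta>
      by (simp add: field_simps)
    finally show ?thesis .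
  qed
  have g_pos: "g t i > 0" if "t \<in> {0..1}" for t i
    using h[OF that, of i] by (simp add: g_def)
  have S: "diag_cong C (g t) \<in> SPD" if "t \<in> {0..1}" for t
    unfolding diag_cong_SPD_iff[OF C] using g_pos[OF that] by blast
  have ac: "- alpha_connection \<beta> (diag_cong C (g t)) (diag_cong C (g1 t)) (diag_cong C (g1 t)) =
      diag_cong C (\<lambda>i. (1 - \<beta>) * (g1 t i * g1 t i / g t i))" if t: "t \<in> {0..1}" for t
  proof -
    have g0: "g t i \<noteq> 0" for i using h[OF t, of i] by (simp add: g_def)
    have sc: "c *\<^sub>R diag_cong C a = diag_cong C (\<lambda>i. c * a i)" for c a
    proof -
      have "diag (\<lambda>i. c * a i) = c *\<^sub>R diag a" by (simp add: vec_eq_iff diag_def)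
      then show ?thesis by (simp add: diag_cong_def matmul.scaleR_left matmul.scaleR_right)
    qed
    show ?thesis
      by (simp add: alpha_connection_self[OF S[OF t] diag_cong_Sym] diag_cong_quadratic[OF C g0] sc)
  qed
  have "is_geodesic (alpha_connection \<beta>) (\<lambda>t. diag_cong C (g t))"
    unfolding is_geodesic_def
  proof (intro conjI ballI exI[of _ "\<lambda>t. diag_cong C (g1 t)"])
    fix t :: real assume t: "t \<in> {0..1}"
    show "diag_cong C (g t) \<in> SPD" by (rule S[OF t])
    show "((\<lambda>t. diag_cong C (g t)) has_vector_derivative diag_cong C (g1 t)) (at t within {0..1})"
      by (rule has_vector_derivative_diag_cong[OF D1[OF t]])
    show "((\<lambda>t. diag_cong C (g1 t)) has_vector_derivative
        - alpha_connection \<beta> (diag_cong C (g t)) (diag_cong C (g1 t)) (diag_cong C (g1 t))) (at t within {0..1})"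
      unfolding ac[OF t] by (rule has_vector_derivative_diag_cong[OF D2[OF t]])
  qed
  then show ?thesis by (simp add: g_def[abs_def] h_def c_def)
qed

text \<open>The \<open>\<beta>\<close>-power mean of \<open>1\<close> and \<open>s\<close>.\<close>

definition power_mean :: "real \<Rightarrow> real \<Rightarrow> real" where
  "power_mean \<beta> s = ((1 + s powr \<beta>) / 2) powr (1 / \<beta>)"

lemma power_mean_pos: "s > 0 \<Longrightarrow> power_mean \<beta> s > 0"
  using add_pos_nonneg[of 1 "s powr \<beta>"] by (simp add: power_mean_def)

text \<open>
  The geodesic between two points need not be diagonal in the given frame \<open>C\<close> a priori, because the
  frame of \<open>geodesic_closed_form\<close> comes from the initial velocity. But that frame also diagonalizes the
  end points, and the midpoint is the same function of the end points in every frame.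
\<close>

lemma geodesic_midpoint_alpha_connection:
  fixes C :: "real^'n^'n"
  assumes \<beta>: "\<beta> \<noteq> 0" and C: "invertible C" and s: "\<And>i. s i > 0"
  shows "geodesic_midpoint (alpha_connection \<beta>) (diag_cong C (\<lambda>_. 1)) (diag_cong C s) =
    diag_cong C (\<lambda>i. power_mean \<beta> (s i))"
  unfolding geodesic_midpoint_def
proof (rule the_equality)
  let ?g = "\<lambda>t. diag_cong C (\<lambda>i. (1 + t * (s i powr \<beta> - 1)) powr (1 / \<beta>))"
  have "1 + 1 / 2 * (x - 1) = (1 + x) / 2" for x :: real by (simp add: field_simps)
  then have mid: "diag_cong C (\<lambda>i. power_mean \<beta> (s i)) = ?g (1 / 2)"
    by (simp only: power_mean_def)
  have one: "?g 1 = diag_cong C s"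
    using s \<beta> by (simp add: powr_powr abs_of_pos)
  have zero: "?g 0 = diag_cong C (\<lambda>_. 1)" by simp
  show "\<exists>\<gamma>. is_geodesic (alpha_connection \<beta>) \<gamma> \<and> \<gamma> 0 = diag_cong C (\<lambda>_. 1) \<and>
      \<gamma> 1 = diag_cong C s \<and> diag_cong C (\<lambda>i. power_mean \<beta> (s i)) = \<gamma> (1 / 2)"
    using is_geodesic_power_curve[OF \<beta> C s] mid one zero by (intro exI[of _ ?g] conjI) auto
next
  fix R
  assume "\<exists>\<gamma>. is_geodesic (alpha_connection \<beta>) \<gamma> \<and> \<gamma> 0 = diag_cong C (\<lambda>_. 1) \<and>
      \<gamma> 1 = diag_cong C s \<and> R = \<gamma> (1 / 2)"
  then obtain \<gamma> where geo: "is_geodesic (alpha_connection \<beta>) \<gamma>" and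
    \<gamma>0: "\<gamma> 0 = diag_cong C (\<lambda>_. 1)" and \<gamma>1: "\<gamma> 1 = diag_cong C s" and R: "R = \<gamma> (1 / 2)" by blast
  obtain C' d where C': "invertible C'" and
    pos: "\<And>t i. t \<in> {0..1} \<Longrightarrow> 1 + \<beta> * t * d i > 0" and
    form: "\<And>t. t \<in> {0..1} \<Longrightarrow> \<gamma> t = diag_cong C' (\<lambda>i. (1 + \<beta> * t * d i) powr (1 / \<beta>))"
    using geodesic_closed_form[OF \<beta> geo] by blast
  define s' where "s' i = (1 + \<beta> * d i) powr (1 / \<beta>)" for i
  have "diag_cong C (\<lambda>_. 1) = diag_cong C' (\<lambda>_. 1)" using form[of 0] \<gamma>0 by simp
  moreover have "diag_cong C s = diag_cong C' s'" using form[of 1] \<gamma>1 by (simp add: s'_def[abs_def])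
  ultimately have "diag_cong C (\<lambda>i. power_mean \<beta> (s i)) = diag_cong C' (\<lambda>i. power_mean \<beta> (s' i))"
    by (rule diag_cong_functional_calculus[OF C C'])
  also have "\<dots> = diag_cong C' (\<lambda>i. (1 + \<beta> * (1 / 2) * d i) powr (1 / \<beta>))"
  proof (rule arg_cong[of _ _ "diag_cong C'"], rule ext)
    fix i
    have "(1 + s' i powr \<beta>) / 2 = 1 + \<beta> * (1 / 2) * d i"
      using pos[of 1 i] \<beta> by (simp add: s'_def powr_powr field_simps)
    then show "power_mean \<beta> (s' i) = (1 + \<beta> * (1 / 2) * d i) powr (1 / \<beta>)"
      by (simp only: power_mean_def)
  qed
  also have "\<dots> = R" unfolding R by (rule form[symmetric]) simp
  finally show "R = diag_cong C (\<lambda>i. power_mean \<beta> (s i))" ..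
qed

section \<open>The recursion for the half log-spread\<close>

lemma half_log_spread_diag_cong:
  assumes "invertible C" "\<And>i. p i > 0"
  shows "half_log_spread (diag_cong C p) (diag_cong C q) = Max (range (\<lambda>i. \<bar>ln (q i / p i)\<bar> / 2))"
proof -
  have "half_log_spread (diag_cong C p) (diag_cong C q) = 1 / 2 * Max (range (\<lambda>i. \<bar>ln (q i / p i)\<bar>))"
    by (simp add: half_log_spread_def eigenvalues_diag_cong[OF assms] image_image)
  also have "\<dots> = Max ((\<lambda>x. 1 / 2 * x) ` range (\<lambda>i. \<bar>ln (q i / p i)\<bar>))"
    by (rule mono_Max_commute) (auto intro: monoI)
  finally show ?thesis by (simp add: image_image)
qed

text \<open>
  With \<open>x = \<alpha> ln s\<close>, the ratio of the two means is
  \<open>(((1 + e\<^sup>x) / 2) ((1 + e\<^sup>-\<^sup>x) / 2))\<^sup>-\<^sup>1\<^sup>/\<^sup>\<alpha>\<close>, and the product inside is \<open>cosh\<^sup>2 (x / 2)\<close>.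
\<close>

lemma power_mean_ratio:
  assumes \<alpha>: "\<alpha> \<noteq> 0" and s: "s > 0"
  shows "\<bar>ln (power_mean (- \<alpha>) s / power_mean \<alpha> s)\<bar> / 2 =
    ln (cosh (\<bar>\<alpha>\<bar> * (\<bar>ln s\<bar> / 2))) / \<bar>\<alpha>\<bar>"
proof -
  define x where "x = \<alpha> * ln s"
  have pw: "s powr \<alpha> = exp x" "s powr (- \<alpha>) = exp (- x)"
    using s by (simp_all add: powr_def x_def mult.commute)
  have pos: "1 + exp x > 0" "1 + exp (- x) > 0" by (simp_all add: add_pos_pos)
  have "ln (power_mean (- \<alpha>) s / power_mean \<alpha> s) =
      - (ln ((1 + exp (- x)) / 2) / \<alpha>) - ln ((1 + exp x) / 2) / \<alpha>"
    using pos by (simp add: power_mean_def pw ln_div ln_powr)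
  also have "\<dots> = - (ln ((1 + exp (- x)) / 2) + ln ((1 + exp x) / 2)) / \<alpha>"
    by (simp add: add_divide_distrib diff_divide_distrib)
  also have "ln ((1 + exp (- x)) / 2) + ln ((1 + exp x) / 2) = ln (((1 + exp (- x)) / 2) * ((1 + exp x) / 2))"
    using pos by (subst ln_mult) auto
  also have "((1 + exp (- x)) / 2) * ((1 + exp x) / 2) = (cosh (x / 2))\<^sup>2"
  proof -
    have e: "exp x = exp (x / 2) * exp (x / 2)" "exp (- x) = exp (- (x / 2)) * exp (- (x / 2))"
      by (simp_all add: exp_add[symmetric])
    have "exp (x / 2) * exp (- (x / 2)) = 1" by (simp add: exp_minus)
    then show ?thesis unfolding e cosh_def by (simp add: power2_eq_square field_simps)
  qed
  also have "ln ((cosh (x / 2))\<^sup>2) = 2 * ln (cosh (x / 2))"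
    by (simp add: ln_realpow)
  also have "cosh (x / 2) = cosh (\<bar>\<alpha>\<bar> * (\<bar>ln s\<bar> / 2))"
  proof -
    have "cosh \<bar>x / 2\<bar> = cosh (x / 2)" by (rule cosh_real_abs)
    moreover have "\<bar>x / 2\<bar> = \<bar>\<alpha>\<bar> * (\<bar>ln s\<bar> / 2)" by (simp add: x_def abs_mult)
    ultimately show ?thesis by simp
  qed
  finally have "ln (power_mean (- \<alpha>) s / power_mean \<alpha> s) = - (2 * ln (cosh (\<bar>\<alpha>\<bar> * (\<bar>ln s\<bar> / 2)))) / \<alpha>" .
  moreover have "ln (cosh (\<bar>\<alpha>\<bar> * (\<bar>ln s\<bar> / 2))) \<ge> 0" by (simp add: cosh_real_ge_1)
  ultimately show ?thesis by (simp add: abs_divide)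
qed

text \<open>
  All eigenvalues follow the same law, and on the nonnegative half-line that law is increasing in the
  absolute logarithm. The largest one therefore stays the largest.
\<close>

lemma midpoint_step:
  assumes \<alpha>: "\<alpha> \<noteq> 0" and P: "P \<in> SPD" and Q: "Q \<in> SPD"
  shows "A_mid \<alpha> P Q \<in> SPD" and "M_mid \<alpha> P Q \<in> SPD"
    and "half_log_spread (A_mid \<alpha> P Q) (M_mid \<alpha> P Q) =
      ln (cosh (\<bar>\<alpha>\<bar> * half_log_spread P Q)) / \<bar>\<alpha>\<bar>"
proof -
  obtain C s where C: "invertible C" and Pd: "P = diag_cong C (\<lambda>_. 1)" and
    Qd: "Q = diag_cong C s" and s: "\<And>i. s i > 0"
    using SPD_diagonalization[OF P Q] by blast
  have A: "A_mid \<alpha> P Q = diag_cong C (\<lambda>i. power_mean \<alpha> (s i))"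
    unfolding A_mid_def Pd Qd by (rule geodesic_midpoint_alpha_connection[OF \<alpha> C s])
  have M: "M_mid \<alpha> P Q = diag_cong C (\<lambda>i. power_mean (- \<alpha>) (s i))"
    unfolding M_mid_def Pd Qd by (rule geodesic_midpoint_alpha_connection[OF _ C s]) (simp add: \<alpha>)
  show "A_mid \<alpha> P Q \<in> SPD" "M_mid \<alpha> P Q \<in> SPD"
    unfolding A M diag_cong_SPD_iff[OF C] using power_mean_pos[OF s] by blast+
  let ?F = "\<lambda>x. ln (cosh (\<bar>\<alpha>\<bar> * x)) / \<bar>\<alpha>\<bar>"
  let ?R = "range (\<lambda>i. \<bar>ln (s i)\<bar> / 2)"
  have F_mono: "?F x \<le> ?F y" if "0 \<le> x" "x \<le> y" for x y
    using that \<alpha> by (intro divide_right_mono ln_mono cosh_real_pos)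
      (auto simp: cosh_real_nonneg_le_iff mult_left_mono)
  have hPQ: "half_log_spread P Q = Max ?R"
    unfolding Pd Qd by (simp add: half_log_spread_diag_cong[OF C])
  have "half_log_spread (A_mid \<alpha> P Q) (M_mid \<alpha> P Q) =
      Max (range (\<lambda>i. \<bar>ln (power_mean (- \<alpha>) (s i) / power_mean \<alpha> (s i))\<bar> / 2))"
    unfolding A M by (rule half_log_spread_diag_cong[OF C power_mean_pos[OF s]])
  also have "\<dots> = Max (?F ` ?R)"
    by (simp only: power_mean_ratio[OF \<alpha> s] image_image)
  also have "\<dots> = ?F (Max ?R)"
  proof (rule Max_eqI)
    show "?F (Max ?R) \<in> ?F ` ?R" by (intro imageI Max_in) auto
    fix y assume "y \<in> ?F ` ?R"
    then obtain x where x: "x \<in> ?R" "y = ?F x" by blast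
    then have "0 \<le> x" by auto
    moreover have "x \<le> Max ?R" using x by (intro Max_ge) auto
    ultimately show "y \<le> ?F (Max ?R)" unfolding x(2) by (rule F_mono)
  qed simp
  finally show "half_log_spread (A_mid \<alpha> P Q) (M_mid \<alpha> P Q) = ?F (half_log_spread P Q)"
    unfolding hPQ .
qed

lemma half_log_spread_pos:
  assumes P: "P \<in> SPD" and Q: "Q \<in> SPD" and "P \<noteq> Q"
  shows "half_log_spread P Q > 0"
proof -
  obtain C s where C: "invertible C" and Pd: "P = diag_cong C (\<lambda>_. 1)" and
    Qd: "Q = diag_cong C s" and s: "\<And>i. s i > 0"
    using SPD_diagonalization[OF P Q] by blast
  obtain i where i: "s i \<noteq> 1" using \<open>P \<noteq> Q\<close> unfolding Pd Qd by (metis ext)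
  have "0 < \<bar>ln (s i)\<bar> / 2" using i s[of i] by simp
  also have "\<dots> \<le> Max (range (\<lambda>i. \<bar>ln (s i)\<bar> / 2))" by (rule Max_ge) auto
  also have "\<dots> = half_log_spread P Q"
    unfolding Pd Qd by (simp add: half_log_spread_diag_cong[OF C])
  finally show ?thesis .
qed

section \<open>Doubling of the hyperbolic parameter\<close>

lemma tanh_artanh:
  fixes x :: real
  assumes "0 < x" "x < 1"
  shows "tanh (artanh x) = x"
proof -
  have "exp (- 2 * artanh x) = (1 - x) / (1 + x)"
    using assms by (simp add: artanh_def exp_minus)
  then have "tanh (artanh x) = (1 - (1 - x) / (1 + x)) / (1 + (1 - x) / (1 + x))"
    by (simp only: tanh_real_altdef)
  also have "\<dots> = x" using assms by (simp add: field_simps)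
  finally show ?thesis .
qed

lemma artanh_pos: "0 < x \<Longrightarrow> x < 1 \<Longrightarrow> artanh (x::real) > 0"
  by (simp add: artanh_def less_divide_eq)

lemma ln_coth: "x > 0 \<Longrightarrow> ln (coth x) = - ln (tanh x)"
  by (simp add: coth_def tanh_def ln_div)

lemma cosh_ln_coth:
  assumes "x > 0"
  shows "cosh (ln (coth x)) = coth (2 * x)"
proof -
  have "sinh x > 0" "cosh x > 0" using assms by auto
  then show ?thesis
    unfolding coth_def cosh_double sinh_double
    by (simp add: cosh_ln_real power2_eq_square field_simps)
qed

text \<open>
  Via \<open>a \<delta> = ln (coth x)\<close> the recursion \<open>a \<delta> \<mapsto> ln (cosh (a \<delta>))\<close> is conjugate to \<open>x \<mapsto> 2 x\<close>.
\<close>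

lemma ln_coth_doubling:
  fixes \<delta> :: "nat \<Rightarrow> real"
  assumes a: "a > 0" and \<delta>0: "\<delta> 0 > 0"
    and step: "\<And>n. \<delta> (Suc n) = ln (cosh (a * \<delta> n)) / a"
    and \<theta>: "\<theta> = artanh (exp (- a * \<delta> 0))"
  shows "\<delta> n = ln (coth (2 ^ n * \<theta>)) / a"
proof (induction n)
  case 0
  have e: "0 < exp (- a * \<delta> 0)" "exp (- a * \<delta> 0) < 1" using a \<delta>0 by auto
  have "ln (coth \<theta>) = - ln (tanh \<theta>)" using ln_coth artanh_pos[OF e] \<theta> by simp
  also have "\<dots> = a * \<delta> 0" unfolding \<theta> tanh_artanh[OF e] by simp
  finally show ?case using a by simp
next
  case (Suc n)
  have "exp (- a * \<delta> 0) < 1" using a \<delta>0 by auto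
  then have "2 ^ n * \<theta> > 0" using artanh_pos[of "exp (- a * \<delta> 0)"] \<theta> by simp
  then show ?case using a cosh_ln_coth[of "2 ^ n * \<theta>"] by (simp add: step Suc.IH mult.assoc)
qed

lemma least_doubling_threshold:
  assumes a: "a > 0" and \<theta>: "\<theta> > 0" and \<epsilon>: "\<epsilon> > 0"
    and \<delta>: "\<And>n. \<delta> n = ln (coth (2 ^ n * \<theta>)) / a"
    and less: "\<epsilon> < \<delta> 0"
  shows "(\<exists>n. \<delta> n \<le> \<epsilon>) \<and> int (LEAST n. \<delta> n \<le> \<epsilon>) = \<lceil>log 2 (artanh (exp (- a * \<epsilon>)) / \<theta>)\<rceil>"
proof -
  define T where "T = artanh (exp (- a * \<epsilon>))"
  have e: "0 < exp (- a * \<epsilon>)" "exp (- a * \<epsilon>) < 1" using a \<epsilon> by auto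
  have T: "T > 0" "tanh T = exp (- a * \<epsilon>)" using artanh_pos[OF e] tanh_artanh[OF e] by (auto simp: T_def)
  have iff: "\<delta> n \<le> \<epsilon> \<longleftrightarrow> log 2 (T / \<theta>) \<le> real n" for n
  proof -
    have p: "2 ^ n * \<theta> > 0" using \<theta> by simp
    have "\<delta> n \<le> \<epsilon> \<longleftrightarrow> - ln (tanh (2 ^ n * \<theta>)) \<le> a * \<epsilon>"
      unfolding \<delta> ln_coth[OF p] pos_divide_le_eq[OF a] by (simp only: mult.commute[of \<epsilon> a])
    also have "\<dots> \<longleftrightarrow> ln (tanh T) \<le> ln (tanh (2 ^ n * \<theta>))" unfolding T(2) by auto
    also have "\<dots> \<longleftrightarrow> T \<le> 2 ^ n * \<theta>" using T(1) p by (simp add: tanh_real_le_iff)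
    also have "\<dots> \<longleftrightarrow> T / \<theta> \<le> 2 powr real n" using \<theta> by (simp add: powr_realpow divide_le_eq)
    also have "\<dots> \<longleftrightarrow> log 2 (T / \<theta>) \<le> real n" using T(1) \<theta> by (subst log_le_iff) auto
    finally show ?thesis .
  qed
  \<comment> \<open>the hypothesis \<open>\<epsilon> < \<delta> 0\<close> makes the logarithm positive, hence its ceiling a natural number\<close>
  have "log 2 (T / \<theta>) > 0" using less iff[of 0] by linarith
  then have nat: "int (nat \<lceil>log 2 (T / \<theta>)\<rceil>) = \<lceil>log 2 (T / \<theta>)\<rceil>" by simp
  have "(LEAST n. \<delta> n \<le> \<epsilon>) = nat \<lceil>log 2 (T / \<theta>)\<rceil>"
    unfolding iff by (rule Least_equality) linarith+
  moreover have "\<delta> (nat \<lceil>log 2 (T / \<theta>)\<rceil>) \<le> \<epsilon>" unfolding iff by linarith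
  ultimately show ?thesis using nat unfolding T_def[symmetric] by auto
qed

theorem corollary5p2:
  fixes \<alpha> :: real
    and P Q :: "real^'n^'n"
    and Ps Qs :: "nat \<Rightarrow> real^'n^'n"
    and \<delta> :: "nat \<Rightarrow> real"
    and \<theta> :: real
  assumes "\<alpha> \<noteq> 0"
    and "P \<in> SPD" and "Q \<in> SPD" and "P \<noteq> Q"
    and "Ps 0 = P" and "Qs 0 = Q"
    and "\<And>n. Ps (Suc n) = A_mid \<alpha> (Ps n) (Qs n)"
    and "\<And>n. Qs (Suc n) = M_mid \<alpha> (Ps n) (Qs n)"
    and "\<And>n. \<delta> n = half_log_spread (Ps n) (Qs n)"
    and "\<theta> = artanh (exp (- \<bar>\<alpha>\<bar> * \<delta> 0))"
  shows "(\<forall>n. \<delta> n = inverse \<bar>\<alpha>\<bar> * ln (coth (2 ^ n * \<theta>))) \<and>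
         (\<forall>\<epsilon>\<in>{0<..<\<delta> 0}.
            (\<exists>n. \<delta> n \<le> \<epsilon>) \<and>
            int (LEAST n. \<delta> n \<le> \<epsilon>) = \<lceil>log 2 (artanh (exp (- \<bar>\<alpha>\<bar> * \<epsilon>)) / \<theta>)\<rceil>)"
proof -
  have SPD: "Ps n \<in> SPD \<and> Qs n \<in> SPD" for n
    by (induction n) (simp_all add: assms midpoint_step)
  have step: "\<delta> (Suc n) = ln (cosh (\<bar>\<alpha>\<bar> * \<delta> n)) / \<bar>\<alpha>\<bar>" for n
    using midpoint_step(3)[OF assms(1), of "Ps n" "Qs n"] SPD[of n] by (simp add: assms(7-9))
  have a: "\<bar>\<alpha>\<bar> > 0" using assms(1) by simp
  have \<delta>0: "\<delta> 0 > 0" using half_log_spread_pos[OF assms(2-4)] by (simp add: assms(5,6,9))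
  have \<theta>: "\<theta> > 0" unfolding assms(10) using a \<delta>0 by (intro artanh_pos) auto
  note formula = ln_coth_doubling[OF a \<delta>0 step assms(10)]
  show ?thesis
  proof (intro conjI allI ballI)
    show "\<delta> n = inverse \<bar>\<alpha>\<bar> * ln (coth (2 ^ n * \<theta>))" for n
      using formula[of n] by (simp add: divide_inverse mult.commute)
  qed (use least_doubling_threshold[OF a \<theta> _ formula] in auto)
qed

end
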